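(* Let $\mathbb{K}$ be a field, let $I\subset S=\mathbb{K}[X_1,\ldots,X_n]$ be a proper monomial ideal, let $I^p\subset S'$ be its polarization, where $S'$ is a polynomial ring in $n'$ variables over $\mathbb{K}$, and put $c=n'-n$. Then $$\operatorname{size} I^p\le \operatorname{size} I+c,$$ where $\operatorname{size} I$ is computed in $S$ and $\operatorname{size} I^p$ is computed in $S'$.
   Context: Size. Let $J$ be a proper monomial ideal in a polynomial ring $R$ in $N$ variables over a field, and let $J=\bigcap_{i=1}^s U_i$ be an irredundant primary decomposition with all $U_i$ monomial ideals. The size of $J$ is $\operatorname{size} J=v+(N-h)-1$, where $v$ is the minimum number $t\le s$ such that there exist $i_1<\cdots<i_t$ with $\sqrt{\sum_{j=1}^t U_{i_j}}=\sqrt{\sum_{i=1}^s U_i}$, and $h=\operatorname{height}\sum_{i=1}^s U_i$. This depends only on the set of associated primes of $R/J$ (and on $N$). Polarization. Let $I\subset S=\mathbb{K}[X_1,\ldots,X_n]$ be a monomial ideal with minimal monomial generators $u_1,\ldots,u_m$, $u_i=\prod_{k=1}^n X_k^{a_{ik}}$. For each $k$ let $a_k=\max\{a_{ik}: i=1,\ldots,m\}$. Let $S'=\mathbb{K}[X_{k,l}: 1\le k\le n,\ 1\le l\le a_k]$, a polynomial ring in $n'=\sum_{k=1}^n a_k$ variables. The polarization of $I$ is the squarefree monomial ideal $I^p\subset S'$ generated by $v_1,\ldots,v_m$, where $v_i=\prod_{k=1}^n\prod_{l=1}^{a_{ik}}X_{k,l}$. *)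

theory Defs
  imports "HOL-Algebra.Ideal" "HOL-Library.Poly_Mapping" "HOL-Library.Extended_Nat"
begin

section \<open>Polynomial rings with a prescribed set of variables\<close>

text \<open>
  An exponent vector is a finitely supported function \<open>'v \<Rightarrow>\<^sub>0 nat\<close>, and a polynomial is a finitely
  supported family of coefficients indexed by exponent vectors.  Since the variables of a
  polarization depend on the ideal, the ring \<open>K[X\<^sub>v : v \<in> V]\<close> is singled out by a carrier.
\<close>

type_synonym ('v, 'k) mpoly = "('v \<Rightarrow>\<^sub>0 nat) \<Rightarrow>\<^sub>0 'k"

definition mpoly_ring :: "'v set \<Rightarrow> ('v, 'k::field) mpoly ring" where
  "mpoly_ring V = \<lparr>carrier = {p. \<forall>m \<in> Poly_Mapping.keys p. Poly_Mapping.keys m \<subseteq> V},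
     mult = (*), one = 1, zero = 0, add = (+)\<rparr>"

definition monomial :: "('v \<Rightarrow>\<^sub>0 nat) \<Rightarrow> ('v, 'k::field) mpoly" where
  "monomial m = Poly_Mapping.single m 1"

definition var :: "'v \<Rightarrow> ('v, 'k::field) mpoly" where
  "var x = monomial (Poly_Mapping.single x 1)"

definition exps :: "'v set \<Rightarrow> ('v \<Rightarrow>\<^sub>0 nat) set" where
  "exps V = {m. Poly_Mapping.keys m \<subseteq> V}"

definition monomial_ideal :: "'v set \<Rightarrow> ('v, 'k::field) mpoly set \<Rightarrow> bool" where
  "monomial_ideal V J \<longleftrightarrow> (\<exists>M \<subseteq> exps V. J = Idl\<^bsub>mpoly_ring V\<^esub> (monomial ` M))"


section \<open>Radicals, primary ideals, sums and height in a commutative ring\<close>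

definition radical :: "('a, 'b) ring_scheme \<Rightarrow> 'a set \<Rightarrow> 'a set" where
  "radical R J = {a \<in> carrier R. \<exists>n::nat. n > 0 \<and> a [^]\<^bsub>R\<^esub> n \<in> J}"

definition primary_ideal :: "('a, 'b) ring_scheme \<Rightarrow> 'a set \<Rightarrow> bool" where
  "primary_ideal R Q \<longleftrightarrow> ideal Q R \<and> Q \<noteq> carrier R \<and>
     (\<forall>a \<in> carrier R. \<forall>b \<in> carrier R. a \<otimes>\<^bsub>R\<^esub> b \<in> Q \<longrightarrow> a \<in> Q \<or> b \<in> radical R Q)"

definition ideal_sum :: "('a, 'b) ring_scheme \<Rightarrow> (nat \<Rightarrow> 'a set) \<Rightarrow> nat set \<Rightarrow> 'a set" where
  "ideal_sum R U A = {finsum R x A | x. x \<in> Pi A U}"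

definition height_prime :: "('a, 'b) ring_scheme \<Rightarrow> 'a set \<Rightarrow> enat" where
  "height_prime R P = Sup {enat r | r. \<exists>C :: nat \<Rightarrow> 'a set.
     (\<forall>i \<le> r. primeideal (C i) R) \<and> (\<forall>i < r. C i \<subset> C (Suc i)) \<and> C r = P}"

definition height :: "('a, 'b) ring_scheme \<Rightarrow> 'a set \<Rightarrow> enat" where
  "height R J = Inf {height_prime R P | P. primeideal P R \<and> J \<subseteq> P}"


section \<open>Size of a monomial ideal\<close>

text \<open>Irredundant means that no component can be omitted; distinct components may have the same
  radical.\<close>

definition irredundant_primary_decomp ::
  "'v set \<Rightarrow> ('v, 'k::field) mpoly set \<Rightarrow> nat \<Rightarrow> (nat \<Rightarrow> ('v, 'k) mpoly set) \<Rightarrow> bool" where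
  "irredundant_primary_decomp V J s U \<longleftrightarrow>
     s \<ge> 1 \<and>
     (\<forall>i \<in> {1..s}. monomial_ideal V (U i) \<and> primary_ideal (mpoly_ring V) (U i)) \<and>
     J = (\<Inter>i \<in> {1..s}. U i) \<and>
     (\<forall>i \<in> {1..s}. (\<Inter>j \<in> {1..s} - {i}. U j) \<noteq> J)"

text \<open>At least one component has to be chosen.  This matters only when all components are zero,
  that is, for the zero ideal.\<close>

definition cover_number :: "('a, 'b) ring_scheme \<Rightarrow> nat \<Rightarrow> (nat \<Rightarrow> 'a set) \<Rightarrow> nat" where
  "cover_number R s U = (LEAST t. t \<ge> 1 \<and> (\<exists>T \<subseteq> {1..s}. card T = t \<and>
     radical R (ideal_sum R U T) = radical R (ideal_sum R U {1..s})))"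

definition decomp_size :: "'v set \<Rightarrow> nat \<Rightarrow> (nat \<Rightarrow> ('v, 'k::field) mpoly set) \<Rightarrow> int" where
  "decomp_size V s U = int (cover_number (mpoly_ring V) s U)
     + (int (card V) - int (the_enat (height (mpoly_ring V) (ideal_sum (mpoly_ring V) U {1..s})))) - 1"

text \<open>The value does not depend on the decomposition, whence the definite description.\<close>

definition ideal_size :: "'v set \<Rightarrow> ('v, 'k::field) mpoly set \<Rightarrow> int" where
  "ideal_size V J = (THE z. \<exists>s U. irredundant_primary_decomp V J s U \<and> z = decomp_size V s U)"


section \<open>Polarization\<close>

definition mon_dvd :: "('v \<Rightarrow>\<^sub>0 nat) \<Rightarrow> ('v \<Rightarrow>\<^sub>0 nat) \<Rightarrow> bool" where
  "mon_dvd u w \<longleftrightarrow> (\<forall>x. Poly_Mapping.lookup u x \<le> Poly_Mapping.lookup w x)"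

text \<open>Exponent vectors of the minimal monomial generators; see \<open>min_gens_generate\<close> and
  \<open>min_gens_least\<close> below.\<close>

definition min_gens :: "('v, 'k::field) mpoly set \<Rightarrow> ('v \<Rightarrow>\<^sub>0 nat) set" where
  "min_gens I = {u. monomial u \<in> I \<and> (\<forall>w. monomial w \<in> I \<and> mon_dvd w u \<longrightarrow> w = u)}"

text \<open>The inserted 0 only covers the case of no generators, i.e. the zero ideal.\<close>

definition max_exp :: "('v, 'k::field) mpoly set \<Rightarrow> 'v \<Rightarrow> nat" where
  "max_exp I k = Max (insert 0 ((\<lambda>u. Poly_Mapping.lookup u k) ` min_gens I))"

definition pol_vars :: "'v set \<Rightarrow> ('v, 'k::field) mpoly set \<Rightarrow> ('v \<times> nat) set" where
  "pol_vars V I = {(k, l). k \<in> V \<and> 1 \<le> l \<and> l \<le> max_exp I k}"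

definition pol_mon :: "'v set \<Rightarrow> ('v \<Rightarrow>\<^sub>0 nat) \<Rightarrow> ('v \<times> nat, 'k::field) mpoly" where
  "pol_mon V u = (\<Prod>k \<in> V. \<Prod>l \<in> {1..Poly_Mapping.lookup u k}. var (k, l))"

definition polarization :: "'v set \<Rightarrow> ('v, 'k::field) mpoly set \<Rightarrow> ('v \<times> nat, 'k) mpoly set" where
  "polarization V I = Idl\<^bsub>mpoly_ring (pol_vars V I)\<^esub> (pol_mon V ` min_gens I)"


section \<open>Basic facts\<close>

lemma cring_mpoly_ring: "cring (mpoly_ring V :: ('v, 'k::field) mpoly ring)"
proof -
  let ?C = "carrier (mpoly_ring V :: ('v, 'k) mpoly ring)"
  have add: "p + q \<in> ?C" if "p \<in> ?C" "q \<in> ?C" for p q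
    using that Poly_Mapping.keys_add[of p q] by (fastforce simp: mpoly_ring_def)
  have mult: "p * q \<in> ?C" if pq: "p \<in> ?C" "q \<in> ?C" for p q
  proof -
    have "Poly_Mapping.keys m \<subseteq> V" if m: "m \<in> Poly_Mapping.keys (p * q)" for m
    proof -
      obtain a b where "m = a + b" "a \<in> Poly_Mapping.keys p" "b \<in> Poly_Mapping.keys q"
        using subsetD[OF Poly_Mapping.keys_mult m] by blast
      then show ?thesis
        using pq Poly_Mapping.keys_add[of a b] unfolding mpoly_ring_def by fastforce
    qed
    then show ?thesis by (simp add: mpoly_ring_def)
  qed
  have neg: "- p \<in> ?C" if "p \<in> ?C" for p
    using that by (simp add: mpoly_ring_def)
  have const: "0 \<in> ?C" "1 \<in> ?C"
    by (simp_all add: mpoly_ring_def)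
  have ops: "x \<oplus>\<^bsub>mpoly_ring V\<^esub> y = x + y" "x \<otimes>\<^bsub>mpoly_ring V\<^esub> y = x * y"
    "\<zero>\<^bsub>mpoly_ring V\<^esub> = (0 :: ('v, 'k) mpoly)" "\<one>\<^bsub>mpoly_ring V\<^esub> = (1 :: ('v, 'k) mpoly)"
    for x y :: "('v, 'k) mpoly"
    by (simp_all add: mpoly_ring_def)
  show ?thesis
  proof (rule cringI)
    show "abelian_group (mpoly_ring V :: ('v, 'k) mpoly ring)"
    proof (rule abelian_groupI, unfold ops)
      fix p assume "p \<in> ?C"
      then show "\<exists>q \<in> ?C. q + p = 0" using neg by (intro bexI[of _ "- p"]) auto
    qed (simp_all add: add const ac_simps)
    show "Group.comm_monoid (mpoly_ring V :: ('v, 'k) mpoly ring)"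
      by (rule comm_monoidI, unfold ops) (simp_all add: mult const ac_simps)
  qed (simp add: ops distrib_right)
qed

lemma mon_in_carrier:
  "(monomial m :: ('v, 'k::field) mpoly) \<in> carrier (mpoly_ring V) \<longleftrightarrow> m \<in> exps V"
  by (simp add: mpoly_ring_def monomial_def exps_def)

lemma mon_mult: "monomial (a + b) = monomial a * (monomial b :: ('v, 'k::field) mpoly)"
  by (simp add: monomial_def mult_single)

lemma mon_dvd_addE:
  assumes "mon_dvd u w" obtains d where "w = d + u" "Poly_Mapping.keys d \<subseteq> Poly_Mapping.keys w"
proof
  show "w = (w - u) + u"
    using assms by (intro poly_mapping_eqI) (simp add: mon_dvd_def lookup_add lookup_minus)
  show "Poly_Mapping.keys (w - u) \<subseteq> Poly_Mapping.keys w"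
    by (auto simp: in_keys_iff lookup_minus)
qed

lemma mon_dvd_refl: "mon_dvd u u" and mon_dvd_trans: "mon_dvd u v \<Longrightarrow> mon_dvd v w \<Longrightarrow> mon_dvd u w"
  by (auto simp: mon_dvd_def intro: order_trans)

lemma mon_dvd_add: "mon_dvd u w \<Longrightarrow> mon_dvd u (d + w)"
  by (auto simp: mon_dvd_def lookup_add trans_le_add2)

lemma mon_in_Idl:
  assumes M: "M \<subseteq> exps V"
    and w: "(monomial w :: ('v, 'k::field) mpoly) \<in> Idl\<^bsub>mpoly_ring V\<^esub> (monomial ` M)"
  shows "\<exists>u \<in> M. mon_dvd u w"
proof -
  let ?R = "mpoly_ring V :: ('v, 'k) mpoly ring"
  interpret cring ?R by (rule cring_mpoly_ring)
  let ?L = "{p \<in> carrier ?R. \<forall>m \<in> Poly_Mapping.keys p. \<exists>u \<in> M. mon_dvd u m}"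
  have mult: "a * p \<in> ?L" if "a \<in> carrier ?R" "p \<in> ?L" for a p
  proof -
    have "a \<otimes>\<^bsub>?R\<^esub> p \<in> carrier ?R" using that by simp
    moreover have "\<exists>u \<in> M. mon_dvd u m" if "m \<in> Poly_Mapping.keys (a * p)" for m
      using subsetD[OF Poly_Mapping.keys_mult that] \<open>p \<in> ?L\<close> mon_dvd_add by blast
    ultimately show ?thesis by (simp add: mpoly_ring_def)
  qed
  have "ideal ?L ?R"
  proof (rule idealI)
    show "subgroup ?L (add_monoid ?R)"
    proof
      show "?L \<subseteq> carrier (add_monoid ?R)" by auto
      show "\<one>\<^bsub>add_monoid ?R\<^esub> \<in> ?L" by (simp add: mpoly_ring_def)
    next
      fix p q assume p: "p \<in> ?L" and q: "q \<in> ?L"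
      have "p \<oplus>\<^bsub>?R\<^esub> q \<in> carrier ?R" using p q by simp
      moreover have "\<exists>u \<in> M. mon_dvd u m" if "m \<in> Poly_Mapping.keys (p + q)" for m
        using subsetD[OF Poly_Mapping.keys_add that] p q by blast
      ultimately show "p \<otimes>\<^bsub>add_monoid ?R\<^esub> q \<in> ?L" by (simp add: mpoly_ring_def)
    next
      fix p assume p: "p \<in> ?L"
      have c: "- p \<in> carrier ?R" using p by (simp add: mpoly_ring_def)
      have "\<ominus>\<^bsub>?R\<^esub> p = - p"
        using p c by (intro minus_equality) (auto simp: mpoly_ring_def)
      then show "inv\<^bsub>add_monoid ?R\<^esub> p \<in> ?L" using p c by (simp add: a_inv_def)
    qed
  next
    fix p a assume p: "p \<in> ?L" and a: "a \<in> carrier ?R"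
    have "a \<otimes>\<^bsub>?R\<^esub> p = a * p" "p \<otimes>\<^bsub>?R\<^esub> a = a * p"
      by (simp_all add: mpoly_ring_def mult.commute)
    then show "a \<otimes>\<^bsub>?R\<^esub> p \<in> ?L" "p \<otimes>\<^bsub>?R\<^esub> a \<in> ?L"
      using mult[OF a p] by (simp_all only:)
  qed (rule ring_axioms)
  moreover have "monomial ` M \<subseteq> ?L"
  proof
    fix p :: "('v, 'k) mpoly" assume "p \<in> monomial ` M"
    then obtain m where m: "m \<in> M" "p = monomial m" by blast
    then have "p \<in> carrier ?R" using M by (auto simp: mon_in_carrier)
    moreover have "Poly_Mapping.keys p = {m}" by (simp add: m(2) monomial_def)
    moreover have "\<exists>u \<in> M. mon_dvd u m" using m(1) mon_dvd_refl by (rule bexI[rotated])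
    ultimately show "p \<in> ?L" by simp
  qed
  ultimately have "Idl\<^bsub>?R\<^esub> (monomial ` M) \<subseteq> ?L" by (rule genideal_minimal)
  with w have "\<forall>m \<in> Poly_Mapping.keys (monomial w :: ('v, 'k) mpoly). \<exists>u \<in> M. mon_dvd u m" by blast
  then show ?thesis by (simp add: monomial_def)
qed

lemma min_gens_dvd:
  fixes I :: "('v, 'k::field) mpoly set"
  assumes "monomial w \<in> I"
  shows "\<exists>u \<in> min_gens I. mon_dvd u w"
  using assms
proof (induction "sum (Poly_Mapping.lookup w) (Poly_Mapping.keys w)" arbitrary: w rule: less_induct)
  case less
  show ?case
  proof (cases "w \<in> min_gens I")
    case True
    then show ?thesis using mon_dvd_refl by blast
  next
    case False
    then obtain v where v: "monomial v \<in> I" "mon_dvd v w" "v \<noteq> w"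
      using less.prems by (auto simp: min_gens_def)
    have sub: "Poly_Mapping.keys v \<subseteq> Poly_Mapping.keys w"
    proof
      fix x assume "x \<in> Poly_Mapping.keys v"
      moreover have "Poly_Mapping.lookup v x \<le> Poly_Mapping.lookup w x"
        using v(2) by (simp add: mon_dvd_def)
      ultimately show "x \<in> Poly_Mapping.keys w" by (auto simp: in_keys_iff)
    qed
    obtain x where x: "Poly_Mapping.lookup v x \<noteq> Poly_Mapping.lookup w x"
      using v(3) poly_mapping_eqI[of v w] by auto
    with v(2) have lt: "Poly_Mapping.lookup v x < Poly_Mapping.lookup w x"
      unfolding mon_dvd_def by (simp add: le_neq_implies_less)
    have "sum (Poly_Mapping.lookup v) (Poly_Mapping.keys v)
        = sum (Poly_Mapping.lookup v) (Poly_Mapping.keys w)"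
      using sub by (intro sum.mono_neutral_left) (auto simp: in_keys_iff)
    also have "\<dots> < sum (Poly_Mapping.lookup w) (Poly_Mapping.keys w)"
    proof (rule sum_strict_mono_ex1)
      show "\<forall>y \<in> Poly_Mapping.keys w. Poly_Mapping.lookup v y \<le> Poly_Mapping.lookup w y"
        using v(2) by (simp add: mon_dvd_def)
      have "x \<in> Poly_Mapping.keys w" using lt by (simp add: in_keys_iff)
      with lt show "\<exists>y \<in> Poly_Mapping.keys w. Poly_Mapping.lookup v y < Poly_Mapping.lookup w y"
        by blast
    qed simp
    finally obtain u where "u \<in> min_gens I" "mon_dvd u v"
      using less.hyps[OF _ v(1)] by blast
    then show ?thesis using mon_dvd_trans[OF _ v(2)] by blast
  qed
qed

lemma min_gens_generate:
  fixes I :: "('v, 'k::field) mpoly set"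
  assumes "monomial_ideal V I"
  shows "I = Idl\<^bsub>mpoly_ring V\<^esub> (monomial ` min_gens I)" and "min_gens I \<subseteq> exps V"
proof -
  let ?R = "mpoly_ring V :: ('v, 'k) mpoly ring"
  interpret cring ?R by (rule cring_mpoly_ring)
  obtain M where M: "M \<subseteq> exps V" and I: "I = Idl\<^bsub>?R\<^esub> (monomial ` M)"
    using assms by (auto simp: monomial_ideal_def)
  have Mc: "monomial ` M \<subseteq> carrier ?R" using M by (auto simp: mon_in_carrier)
  then interpret I: ideal I ?R unfolding I by (rule genideal_ideal)
  show G: "min_gens I \<subseteq> exps V"
  proof
    fix u assume "u \<in> min_gens I"
    then have "monomial u \<in> carrier ?R" using I.a_subset by (auto simp: min_gens_def)
    then show "u \<in> exps V" by (simp add: mon_in_carrier)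
  qed
  then have Gc: "monomial ` min_gens I \<subseteq> carrier ?R" by (auto simp: mon_in_carrier)
  interpret G: ideal "Idl\<^bsub>?R\<^esub> (monomial ` min_gens I)" ?R using Gc by (rule genideal_ideal)
  have "monomial ` M \<subseteq> Idl\<^bsub>?R\<^esub> (monomial ` min_gens I)"
  proof
    fix p :: "('v, 'k) mpoly" assume "p \<in> monomial ` M"
    then obtain w where w: "w \<in> M" "p = monomial w" by blast
    then have "monomial w \<in> I" using genideal_self[OF Mc] I by blast
    then obtain u where u: "u \<in> min_gens I" "mon_dvd u w" using min_gens_dvd by blast
    obtain d where d: "w = d + u" "Poly_Mapping.keys d \<subseteq> Poly_Mapping.keys w"
      using u(2) by (rule mon_dvd_addE)
    have "monomial d \<in> carrier ?R" using d(2) w(1) M by (auto simp: mon_in_carrier exps_def)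
    moreover have "monomial u \<in> Idl\<^bsub>?R\<^esub> (monomial ` min_gens I)" using genideal_self[OF Gc] u(1) by blast
    ultimately have "monomial d \<otimes>\<^bsub>?R\<^esub> monomial u \<in> Idl\<^bsub>?R\<^esub> (monomial ` min_gens I)" by (rule G.I_l_closed[rotated])
    then show "p \<in> Idl\<^bsub>?R\<^esub> (monomial ` min_gens I)"
      by (simp add: w(2) d(1) mon_mult) (simp add: mpoly_ring_def)
  qed
  then have "I \<subseteq> Idl\<^bsub>?R\<^esub> (monomial ` min_gens I)"
    using genideal_minimal[OF G.ideal_axioms] I by simp
  moreover have "Idl\<^bsub>?R\<^esub> (monomial ` min_gens I) \<subseteq> I"
    by (intro genideal_minimal I.ideal_axioms) (auto simp: min_gens_def)
  ultimately show "I = Idl\<^bsub>?R\<^esub> (monomial ` min_gens I)" by blast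
qed

lemma min_gens_least:
  fixes I :: "('v, 'k::field) mpoly set"
  assumes M: "M \<subseteq> exps V" and I: "I = Idl\<^bsub>mpoly_ring V\<^esub> (monomial ` M)"
  shows "min_gens I \<subseteq> M"
proof
  interpret cring "mpoly_ring V :: ('v, 'k) mpoly ring" by (rule cring_mpoly_ring)
  fix u assume u: "u \<in> min_gens I"
  then obtain w where w: "w \<in> M" "mon_dvd w u"
    using mon_in_Idl[OF M, of u, where ?'k = 'k] unfolding I[symmetric] min_gens_def by blast
  have "monomial ` M \<subseteq> carrier (mpoly_ring V :: ('v, 'k) mpoly ring)"
    using M by (auto simp: mon_in_carrier)
  from genideal_self[OF this] have "monomial w \<in> I" unfolding I[symmetric] using w(1) by blast
  with u w(2) have "w = u" unfolding min_gens_def by blast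
  with w(1) show "u \<in> M" by simp
qed

end

theory Submission
  imports Defs "HOL-Library.Product_Lexorder"
begin

text \<open>
  The size of a monomial ideal depends only on the sets \<open>A\<close> of variables that generate its associated
  primes: it is the least number of such sets covering their union \<open>W\<close>, plus the number of variables
  outside \<open>W\<close>, minus one.  Let a monomial \<open>m\<close> have modulo \<open>I\<close> the annihilator generated by \<open>A\<close>, and
  let \<open>A'\<close> consist of the variables \<open>X(k, m(k) + 1)\<close>, \<open>k \<in> A\<close>.  Then the product of all variables
  outside \<open>A'\<close> has modulo the polarization the annihilator generated by \<open>A'\<close>, so \<open>A'\<close> generates an
  associated prime again.  Hence a minimal cover of \<open>W\<close> lifts to equally many sets covering at least
  \<open>|W|\<close> variables of the polarization, and every variable not yet covered costs at most one more set.

  The height of the prime generated by \<open>A\<close> is \<open>|A|\<close> since prime chains in a polynomial ring are no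
  longer than the number of variables: elements separating the members of a chain are algebraically
  independent.
\<close>

text \<open>\<open>ideal_size\<close> is a definite description over all irredundant primary
  decompositions, so the formula in terms of the sets \<open>A\<close> rests on two separate facts:
  a decomposition exists, and every decomposition yields the same sets. Both become combinatorial
  once a monomial ideal is replaced by the set of its exponent vectors; polynomials with many terms
  matter only for primality, radicals and heights. No decomposition of the polarization is built
  from one of \<open>I\<close>. It is enough that each associated set of \<open>I\<close> is the
  projection, under \<open>(k, l) \<mapsto> k\<close>, of one of the polarization. The projection
  also explains why a lifted cover of \<open>W\<close> contains at least \<open>card W\<close>
  variables. The polarization may have further associated sets, but the inequality tolerates them: a
  newly covered variable raises the cover number by at most one and lowers the number of variables
  outside the union by one.\<close>

abbreviation "keys \<equiv> Poly_Mapping.keys"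
abbreviation "lookup \<equiv> Poly_Mapping.lookup"
abbreviation "single \<equiv> Poly_Mapping.single"

section \<open>Ring operations and exponent vectors\<close>

lemma mpoly_ring_simps [simp]:
  "x \<oplus>\<^bsub>mpoly_ring V\<^esub> y = x + y" "x \<otimes>\<^bsub>mpoly_ring V\<^esub> y = x * y"
  "\<zero>\<^bsub>mpoly_ring V\<^esub> = (0 :: ('v, 'k::field) mpoly)"
  "\<one>\<^bsub>mpoly_ring V\<^esub> = (1 :: ('v, 'k) mpoly)"
  for x y :: "('v, 'k::field) mpoly"
  by (simp_all add: mpoly_ring_def)

lemma nat_pow_mpoly_ring [simp]:
  "p [^]\<^bsub>mpoly_ring V\<^esub> (n::nat) = (p :: ('v, 'k::field) mpoly) ^ n"
proof -
  interpret cring "mpoly_ring V :: ('v, 'k) mpoly ring" by (rule cring_mpoly_ring)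
  show ?thesis by (induction n) (simp_all add: mult.commute)
qed

lemma keys_add_nat: "keys (a + b) = keys a \<union> keys (b :: 'v \<Rightarrow>\<^sub>0 nat)"
  by (auto simp: in_keys_iff lookup_add)

lemma exps_add [simp]: "a + b \<in> exps V \<longleftrightarrow> a \<in> exps V \<and> b \<in> exps V"
  by (auto simp: exps_def keys_add_nat)

lemma exps_single [simp]: "single x k \<in> exps V \<longleftrightarrow> k = 0 \<or> x \<in> V"
  by (auto simp: exps_def)

lemma exps_zero [simp]: "0 \<in> exps V"
  by (simp add: exps_def)

section \<open>Monomial ideals and up-closed sets of exponents\<close>

text \<open>These are the exponent sets of monomial ideals. Under \<open>span_mon\<close>
  intersections correspond to intersections and sums to unions, so decompositions can be handled as
  families of sets.\<close>

definition upset :: "'v set \<Rightarrow> ('v \<Rightarrow>\<^sub>0 nat) set \<Rightarrow> bool" where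
  "upset V E \<longleftrightarrow> E \<subseteq> exps V \<and> (\<forall>u \<in> exps V. \<forall>m \<in> E. u + m \<in> E)"

definition span_mon :: "('v \<Rightarrow>\<^sub>0 nat) set \<Rightarrow> ('v, 'k::field) mpoly set" where
  "span_mon E = {p. keys p \<subseteq> E}"

text \<open>For \<open>A \<subseteq> V\<close>, \<open>span_mon (meets V A)\<close> is the ideal
  generated by the variables in \<open>A\<close>; \<open>A = {}\<close> gives the zero
  ideal.\<close>

definition meets :: "'v set \<Rightarrow> 'v set \<Rightarrow> ('v \<Rightarrow>\<^sub>0 nat) set" where
  "meets V A = {m \<in> exps V. keys m \<inter> A \<noteq> {}}"

definition part :: "('v \<Rightarrow>\<^sub>0 nat) set \<Rightarrow> ('v, 'k::field) mpoly \<Rightarrow> ('v, 'k) mpoly" where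
  "part S p = (\<Sum>m \<in> keys p \<inter> S. single m (lookup p m))"

lemma lookup_part: "lookup (part S p) m = (if m \<in> S then lookup p m else 0)"
  by (auto simp: part_def lookup_sum lookup_single when_def in_keys_iff sum.delta' Int_def)

lemma keys_part [simp]: "keys (part S p) = keys p \<inter> S"
  by (auto simp: in_keys_iff lookup_part split: if_splits)

lemma part_split: "p = part S p + part (- S) p"
  by (rule poly_mapping_eqI) (simp add: lookup_add lookup_part)

lemma carrier_span: "carrier (mpoly_ring V) = span_mon (exps V)"
  by (auto simp: mpoly_ring_def span_mon_def exps_def)

lemma span_mon_mono: "E \<subseteq> F \<Longrightarrow> span_mon E \<subseteq> span_mon F"
  by (auto simp: span_mon_def)

lemma monomial_in_span [simp]: "monomial m \<in> span_mon E \<longleftrightarrow> m \<in> E"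
  by (simp add: monomial_def span_mon_def)

lemma single_in_span: "m \<in> E \<Longrightarrow> single m c \<in> span_mon E"
  by (simp add: span_mon_def)

lemma span_mon_inject: "(span_mon E :: ('v, 'k::field) mpoly set) = span_mon F \<longleftrightarrow> E = F"
proof
  assume eq: "(span_mon E :: ('v, 'k) mpoly set) = span_mon F"
  have "m \<in> E \<longleftrightarrow> m \<in> F" for m
    unfolding monomial_in_span[symmetric, where ?'b = 'k] eq ..
  then show "E = F" by blast
qed simp

lemma span_mon_add: "p \<in> span_mon E \<Longrightarrow> q \<in> span_mon E \<Longrightarrow> p + q \<in> span_mon E"
  using Poly_Mapping.keys_add[of p q] by (auto simp: span_mon_def)

lemma span_mon_diff: "p \<in> span_mon E \<Longrightarrow> q \<in> span_mon E \<Longrightarrow> p - q \<in> span_mon E"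
  using keys_diff[of p q] by (auto simp: span_mon_def)

lemma span_mon_sum: "(\<And>i. i \<in> A \<Longrightarrow> f i \<in> span_mon E) \<Longrightarrow> sum f A \<in> span_mon E"
  using keys_sum[of f A] by (force simp: span_mon_def)

lemma span_mon_mult:
  assumes "upset V E" "a \<in> carrier (mpoly_ring V)" "p \<in> span_mon E"
  shows "a * p \<in> span_mon E"
proof -
  have "m \<in> E" if m: "m \<in> keys (a * p)" for m
  proof -
    obtain u w where "m = u + w" "u \<in> keys a" "w \<in> keys p"
      using subsetD[OF Poly_Mapping.keys_mult m] by blast
    moreover from this have "u \<in> exps V" "w \<in> E"
      using assms by (auto simp: carrier_span span_mon_def)
    ultimately show ?thesis using assms(1) by (simp add: upset_def)
  qed
  then show ?thesis by (auto simp: span_mon_def)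
qed

lemma a_inv_mpoly_ring:
  assumes "(p :: ('v, 'k::field) mpoly) \<in> carrier (mpoly_ring V)"
  shows "\<ominus>\<^bsub>mpoly_ring V\<^esub> p = - p"
proof -
  interpret cring "mpoly_ring V :: ('v, 'k) mpoly ring" by (rule cring_mpoly_ring)
  have "- p \<in> carrier (mpoly_ring V)" using assms by (simp add: mpoly_ring_def)
  with assms show ?thesis by (intro minus_equality) auto
qed

lemma ideal_span_mon:
  assumes E: "upset V E"
  shows "ideal (span_mon E :: ('v, 'k::field) mpoly set) (mpoly_ring V)"
proof -
  let ?R = "mpoly_ring V :: ('v, 'k) mpoly ring"
  interpret cring ?R by (rule cring_mpoly_ring)
  have sub: "(span_mon E :: ('v, 'k) mpoly set) \<subseteq> carrier ?R"
    using E by (simp add: carrier_span upset_def span_mon_mono)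
  show ?thesis
  proof (rule idealI)
    show "subgroup (span_mon E) (add_monoid ?R)"
    proof
      show "\<one>\<^bsub>add_monoid ?R\<^esub> \<in> span_mon E" by (simp add: span_mon_def)
      show "inv\<^bsub>add_monoid ?R\<^esub> p \<in> span_mon E" if "p \<in> span_mon E" for p
        using a_inv_mpoly_ring[OF subsetD[OF sub that]] that by (simp add: a_inv_def span_mon_def)
    qed (use sub span_mon_add in auto)
    show "x \<otimes>\<^bsub>?R\<^esub> a \<in> span_mon E" if "a \<in> span_mon E" "x \<in> carrier ?R" for a x
      using span_mon_mult[OF E that(2,1)] by simp
    show "a \<otimes>\<^bsub>?R\<^esub> x \<in> span_mon E" if "a \<in> span_mon E" "x \<in> carrier ?R" for a x
      using span_mon_mult[OF E that(2,1)] by (simp add: mult.commute)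
  qed (rule ring_axioms)
qed

text \<open>Every polynomial is the finite sum of its terms, and each term is a constant
  \<open>single 0 c\<close> times a monomial of \<open>J\<close>.\<close>

lemma ideal_contains_span:
  assumes "ideal (J :: ('v, 'k::field) mpoly set) (mpoly_ring V)"
    and E: "E \<subseteq> exps V" "\<And>m. m \<in> E \<Longrightarrow> monomial m \<in> J"
  shows "span_mon E \<subseteq> J"
proof
  interpret ideal J "mpoly_ring V" by fact
  fix p :: "('v, 'k) mpoly" assume p: "p \<in> span_mon E"
  have "sum (\<lambda>m. single m (lookup p m)) F \<in> J" if "finite F" "F \<subseteq> keys p" for F
    using that
  proof (induction F)
    case empty
    show ?case using additive_subgroup.zero_closed[OF additive_subgroup_axioms] by simp
  next
    case (insert m F)
    have "m \<in> E" using insert.prems p by (auto simp: span_mon_def)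
    have "single 0 (lookup p m) \<otimes>\<^bsub>mpoly_ring V\<^esub> monomial m \<in> J"
      by (rule I_l_closed) (use E \<open>m \<in> E\<close> in \<open>auto simp: carrier_span single_in_span\<close>)
    then have "single m (lookup p m) \<in> J" by (simp add: monomial_def mult_single)
    then show ?case
      using insert additive_subgroup.a_closed[OF additive_subgroup_axioms] by fastforce
  qed
  from this[of "keys p"] have "part UNIV p \<in> J" by (simp add: part_def)
  moreover have "part UNIV p = p" by (rule poly_mapping_eqI) (simp add: lookup_part)
  ultimately show "p \<in> J" by simp
qed

definition up_closure :: "'v set \<Rightarrow> ('v \<Rightarrow>\<^sub>0 nat) set \<Rightarrow> ('v \<Rightarrow>\<^sub>0 nat) set" where
  "up_closure V M = {w \<in> exps V. \<exists>u \<in> M. mon_dvd u w}"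

lemma mon_dvd_iff: "mon_dvd u w \<longleftrightarrow> (\<exists>d. w = d + u)"
  using mon_dvd_addE mon_dvd_add mon_dvd_refl by metis

lemma upset_up_closure: "upset V (up_closure V M)"
  by (auto simp: upset_def up_closure_def intro: mon_dvd_add)

lemma Idl_monomials:
  assumes M: "M \<subseteq> exps V"
  shows "Idl\<^bsub>mpoly_ring V\<^esub> (monomial ` M) = (span_mon (up_closure V M) :: ('v, 'k::field) mpoly set)"
proof
  let ?R = "mpoly_ring V :: ('v, 'k) mpoly ring"
  interpret cring ?R by (rule cring_mpoly_ring)
  show "Idl\<^bsub>?R\<^esub> (monomial ` M) \<subseteq> span_mon (up_closure V M)"
    using M by (intro genideal_minimal ideal_span_mon upset_up_closure)
      (fastforce simp: up_closure_def intro: mon_dvd_refl)+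
  have Mc: "monomial ` M \<subseteq> carrier ?R" using M by (auto simp: mon_in_carrier)
  then interpret J: ideal "Idl\<^bsub>?R\<^esub> (monomial ` M)" ?R by (rule genideal_ideal)
  show "span_mon (up_closure V M) \<subseteq> Idl\<^bsub>?R\<^esub> (monomial ` M)"
  proof (rule ideal_contains_span[OF J.ideal_axioms])
    fix m assume "m \<in> up_closure V M"
    then obtain u d where u: "u \<in> M" "m = d + u" "m \<in> exps V"
      by (auto simp: up_closure_def mon_dvd_iff)
    then have "monomial d \<otimes>\<^bsub>?R\<^esub> monomial u \<in> Idl\<^bsub>?R\<^esub> (monomial ` M)"
      using genideal_self[OF Mc] by (intro J.I_l_closed) (auto simp: mon_in_carrier)
    then show "monomial m \<in> Idl\<^bsub>?R\<^esub> (monomial ` M)" using u by (simp add: mon_mult)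
  qed (auto simp: up_closure_def)
qed

lemma up_closure_upset: "upset V E \<Longrightarrow> up_closure V E = E"
  by (force simp: upset_def up_closure_def mon_dvd_iff)

lemma monomial_ideal_iff: "monomial_ideal V J \<longleftrightarrow> (\<exists>E. upset V E \<and> J = span_mon E)"
proof
  assume "monomial_ideal V J"
  then show "\<exists>E. upset V E \<and> J = span_mon E"
    using Idl_monomials upset_up_closure by (metis monomial_ideal_def)
next
  assume "\<exists>E. upset V E \<and> J = span_mon E"
  then obtain E where "upset V E" "J = span_mon E" by blast
  then show "monomial_ideal V J"
    unfolding monomial_ideal_def using Idl_monomials[of E V] up_closure_upset
    by (metis upset_def)
qed

section \<open>Primary monomial ideals\<close>

text \<open>Among the terms of \<open>p\<close> outside \<open>E\<close> take those of least degree in the variables of \<open>A\<close>, and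
  multiply them by the terms of \<open>q\<close> free of \<open>A\<close>: nothing else in \<open>p * q\<close> outside \<open>E\<close> has that degree.
  The order on the variables only serves to make the polynomials an integral domain.\<close>

lemma span_mon_mult_cases:
  fixes p q :: "('v::linorder, 'k::field) mpoly"
  assumes A: "finite A" and E: "upset V E"
    and cancel: "\<And>u m. u \<in> exps V \<Longrightarrow> m \<in> exps V \<Longrightarrow> keys u \<inter> A = {} \<Longrightarrow> u + m \<in> E \<Longrightarrow> m \<in> E"
    and p: "p \<in> carrier (mpoly_ring V)" and q: "q \<in> carrier (mpoly_ring V)"
    and pq: "p * q \<in> span_mon E"
  shows "p \<in> span_mon E \<or> q \<in> span_mon (meets V A)"
proof (rule ccontr)
  assume neg: "\<not> ?thesis"
  define deg where "deg m = (\<Sum>x \<in> A. lookup m x)" for m :: "'v \<Rightarrow>\<^sub>0 nat"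
  have deg_add: "deg (a + b) = deg a + deg b" for a b
    by (simp add: deg_def lookup_add sum.distrib)
  have deg_0: "deg m = 0 \<longleftrightarrow> keys m \<inter> A = {}" for m
    using A by (auto simp: deg_def in_keys_iff)
  define p1 where "p1 = part (- E) p"
  define d where "d = Min (deg ` keys p1)"
  define S where "S = {m. deg m = d}"
  define p2 where "p2 = part S p1"
  define p3 where "p3 = part (- S) p1"
  define q0 where "q0 = part (- meets V A) q"
  define q1 where "q1 = part (meets V A) q"
  have "keys p1 \<noteq> {}" using neg by (auto simp: p1_def span_mon_def)
  then have "d \<in> deg ` keys p1" unfolding d_def by (intro Min_in) auto
  then have p2: "p2 \<noteq> 0"
    unfolding p2_def using keys_part[of S p1] S_def by force
  have d_le: "d \<le> deg m" if "m \<in> keys p1" for m using that by (simp add: d_def)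
  have q0: "q0 \<noteq> 0" using neg keys_part[of "- meets V A" q] unfolding q0_def by (force simp: span_mon_def)
  \<comment> \<open>The ring is a domain, so this product has a term \<open>k\<close>. It has degree
    \<open>d\<close> and lies outside \<open>E\<close>. The other two summands of
    \<open>p1 * q\<close> have only terms of larger degree, so \<open>k\<close> survives there,
    although \<open>p1 * q\<close> lies in \<open>span_mon E\<close>.\<close>
  obtain k where k: "k \<in> keys (p2 * q0)" using p2 q0 by (metis keys_eq_empty mult_eq_0_iff ex_in_conv)
  then obtain k1 k2 where k12: "k = k1 + k2" "k1 \<in> keys p2" "k2 \<in> keys q0"
    using subsetD[OF Poly_Mapping.keys_mult] by blast
  have in_exps: "k1 \<in> exps V" "k2 \<in> exps V"
    using k12 p q by (auto simp: p2_def p1_def q0_def carrier_span span_mon_def)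
  have k2: "keys k2 \<inter> A = {}" using k12 in_exps by (auto simp: q0_def meets_def)
  have "k1 \<notin> E" using k12 by (auto simp: p2_def p1_def)
  then have kE: "k \<notin> E" using cancel[OF in_exps(2,1) k2] k12 by (auto simp: add.commute)
  have deg_k: "deg k = d" using k12 deg_0 k2 by (simp add: deg_add p2_def S_def)
  have "p1 * q = p * q - q * part E p"
    using part_split[of p E] by (simp add: p1_def algebra_simps flip: distrib_left)
  moreover have "q * part E p \<in> span_mon E"
    by (intro span_mon_mult[OF E q]) (simp add: span_mon_def)
  ultimately have "p1 * q \<in> span_mon E" using pq span_mon_diff by metis
  then have z: "lookup (p1 * q) k = 0" using kE by (auto simp: span_mon_def in_keys_iff)
  have "k \<notin> keys (p2 * q1)"
  proof
    assume "k \<in> keys (p2 * q1)"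
    then obtain a b where ab: "k = a + b" "a \<in> keys p2" "b \<in> keys q1"
      using subsetD[OF Poly_Mapping.keys_mult] by blast
    then have "deg b > 0" using deg_0[of b] by (auto simp: q1_def meets_def)
    then show False using ab deg_k by (simp add: deg_add p2_def S_def)
  qed
  moreover have "k \<notin> keys (p3 * q)"
  proof
    assume "k \<in> keys (p3 * q)"
    then obtain a b where ab: "k = a + b" "a \<in> keys p3" "b \<in> keys q"
      using subsetD[OF Poly_Mapping.keys_mult] by blast
    then have "deg a > d" using d_le[of a] by (auto simp: p3_def S_def)
    then show False using ab deg_k by (simp add: deg_add)
  qed
  moreover have "p1 * q = p2 * q0 + p2 * q1 + p3 * q"
    using part_split[of p1 S] part_split[of q "meets V A"]
    unfolding p2_def p3_def q0_def q1_def by (metis add.commute distrib_left distrib_right)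
  ultimately show False using z k by (simp add: lookup_add in_keys_iff)
qed

lemma upset_meets: "upset V (meets V A)"
  by (auto simp: upset_def meets_def keys_add_nat)

lemma meets_cancel: "u \<in> exps V \<Longrightarrow> m \<in> exps V \<Longrightarrow> keys u \<inter> A = {} \<Longrightarrow> u + m \<in> meets V A \<Longrightarrow> m \<in> meets V A"
  by (auto simp: meets_def keys_add_nat)

lemma one_notin_meets: "(1 :: ('v, 'k::field) mpoly) \<notin> span_mon (meets V A)"
  by (simp add: span_mon_def meets_def)

text \<open>One inclusion is primality of the ideal generated by \<open>A\<close>. For the other, a
  term of a high power of \<open>p\<close> has high degree in \<open>A\<close>, so by pigeonhole it
  is divisible by one of the powers lying in \<open>E\<close>.\<close>

lemma radical_span_mon:
  fixes A :: "'v::linorder set"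
  assumes A: "finite A" "A \<subseteq> V" and E: "upset V E" "E \<subseteq> meets V A"
    and pow: "\<forall>x \<in> A. \<exists>k. single x k \<in> E"
  shows "radical (mpoly_ring V) (span_mon E) = (span_mon (meets V A) :: ('v, 'k::field) mpoly set)"
proof (intro equalityI subsetI)
  let ?R = "mpoly_ring V :: ('v, 'k) mpoly ring"
  interpret cring ?R by (rule cring_mpoly_ring)
  fix p :: "('v, 'k) mpoly" assume "p \<in> radical ?R (span_mon E)"
  then obtain n where p: "p \<in> carrier ?R" and "p ^ n \<in> span_mon E" by (auto simp: radical_def)
  then have "p ^ n \<in> span_mon (meets V A)" using span_mon_mono[OF E(2)] by blast
  then show "p \<in> span_mon (meets V A)"
  proof (induction n)
    case 0
    then show ?case by (simp add: one_notin_meets)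
  next
    case (Suc n)
    have "p ^ n \<in> carrier ?R" using nat_pow_closed[OF p, of n] by simp
    then have "p \<in> span_mon (meets V A) \<or> p ^ n \<in> span_mon (meets V A)"
      using Suc.prems p by (intro span_mon_mult_cases[OF A(1) upset_meets meets_cancel]) simp_all
    then show ?case using Suc.IH by blast
  qed
next
  let ?R = "mpoly_ring V :: ('v, 'k) mpoly ring"
  interpret cring ?R by (rule cring_mpoly_ring)
  fix p :: "('v, 'k) mpoly" assume p: "p \<in> span_mon (meets V A)"
  have pc: "p \<in> carrier ?R"
    using p span_mon_mono[of "meets V A" "exps V"] by (auto simp: carrier_span meets_def)
  obtain k where k: "\<And>x. x \<in> A \<Longrightarrow> single x (k x) \<in> E" using pow by metis
  \<comment> \<open>If every \<open>x\<close> in \<open>A\<close> had exponent below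
    \<open>k x\<close>, the degree in \<open>A\<close> would be at most \<open>sum k A\<close>.
    Adding 1 exceeds this bound also for empty \<open>A\<close> and makes the exponent positive, as
    \<open>radical\<close> demands.\<close>
  define N where "N = sum k A + 1"
  have deg: "n \<le> (\<Sum>x \<in> A. lookup m x)" if "m \<in> keys (p ^ n)" for n m
    using that
  proof (induction n arbitrary: m)
    case (Suc n)
    then obtain a b where ab: "m = a + b" "a \<in> keys p" "b \<in> keys (p ^ n)"
      using subsetD[OF Poly_Mapping.keys_mult, of m p "p ^ n"] by auto
    then have "a \<in> meets V A" using p by (auto simp: span_mon_def)
    then have "(\<Sum>x \<in> A. lookup a x) \<noteq> 0" using A(1) by (auto simp: meets_def in_keys_iff)
    with Suc.IH[OF ab(3)] show ?case by (simp add: ab(1) lookup_add sum.distrib)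
  qed simp
  have "m \<in> E" if m: "m \<in> keys (p ^ N)" for m
  proof -
    have "\<exists>x \<in> A. k x \<le> lookup m x"
    proof (rule ccontr)
      assume "\<not> ?thesis"
      then have "(\<Sum>x \<in> A. lookup m x) \<le> sum k A" by (intro sum_mono) (auto simp: not_le)
      then show False using deg[OF m] by (simp add: N_def)
    qed
    then obtain x where x: "x \<in> A" "k x \<le> lookup m x" by blast
    have "m \<in> exps V"
      using nat_pow_closed[OF pc, of N] m by (auto simp: carrier_span span_mon_def)
    have "mon_dvd (single x (k x)) m" using x(2) by (simp add: mon_dvd_def lookup_single when_def)
    with k[OF x(1)] \<open>m \<in> exps V\<close> have "m \<in> up_closure V E" by (auto simp: up_closure_def)
    then show ?thesis using up_closure_upset[OF E(1)] by simp
  qed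
  then have "p ^ N \<in> span_mon E" by (auto simp: span_mon_def)
  then show "p \<in> radical ?R (span_mon E)"
    unfolding radical_def using pc by (auto simp: N_def intro!: exI[of _ N])
qed

text \<open>Combinatorial form of a primary ideal whose radical is generated by \<open>A\<close>: it
  contains a power of each variable in \<open>A\<close>, and factors free of \<open>A\<close> can be
  cancelled. \<open>0 \<notin> E\<close> says that it is proper.\<close>

definition primary_exps :: "'v set \<Rightarrow> 'v set \<Rightarrow> ('v \<Rightarrow>\<^sub>0 nat) set \<Rightarrow> bool" where
  "primary_exps V A E \<longleftrightarrow> upset V E \<and> A \<subseteq> V \<and> 0 \<notin> E \<and> (\<forall>x \<in> A. \<exists>k. single x k \<in> E) \<and>
     (\<forall>u \<in> exps V. \<forall>m \<in> exps V. keys u \<inter> A = {} \<longrightarrow> u + m \<in> E \<longrightarrow> m \<in> E)"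

lemma primary_exps_subset: "primary_exps V A E \<Longrightarrow> E \<subseteq> meets V A"
  unfolding primary_exps_def upset_def meets_def
  by clarify (metis add.right_neutral exps_zero subsetD)

lemma primary_ideal_span_mon:
  fixes A :: "'v::linorder set"
  assumes "finite A" and E: "primary_exps V A E"
  shows "primary_ideal (mpoly_ring V) (span_mon E :: ('v, 'k::field) mpoly set)"
proof -
  note E' = E[unfolded primary_exps_def]
  have rad: "radical (mpoly_ring V) (span_mon E :: ('v, 'k) mpoly set) = span_mon (meets V A)"
    using E' assms primary_exps_subset[OF E] by (intro radical_span_mon) auto
  have "E \<noteq> exps V" using E' exps_zero by blast
  then have "(span_mon E :: ('v, 'k) mpoly set) \<noteq> carrier (mpoly_ring V)"
    by (simp add: carrier_span span_mon_inject)
  moreover have "a \<in> span_mon E \<or> b \<in> span_mon (meets V A)"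
    if "a \<in> carrier (mpoly_ring V)" "b \<in> carrier (mpoly_ring V)" "a * b \<in> span_mon E"
    for a b :: "('v, 'k) mpoly"
    using E' that by (intro span_mon_mult_cases[OF assms(1)]) blast+
  ultimately show ?thesis
    unfolding primary_ideal_def rad using E' ideal_span_mon[of V E] by simp
qed

lemma monomial_pow: "monomial (single x l) ^ n = (monomial (single x (n * l)) :: ('v, 'k::field) mpoly)"
  by (induction n) (simp_all add: monomial_def mult_single flip: single_add)

text \<open>\<open>A\<close> consists of the variables with a power in \<open>E\<close>. A factor
  free of \<open>A\<close> is cancelled variable by variable: no power of such a variable lies in
  \<open>E\<close>, so the primary property moves the remaining monomial into
  \<open>E\<close>.\<close>

lemma primary_ideal_exps:
  assumes "monomial_ideal V (U :: ('v, 'k::field) mpoly set)" and prim: "primary_ideal (mpoly_ring V) U"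
  obtains A E where "U = span_mon E" "primary_exps V A E"
proof -
  let ?R = "mpoly_ring V :: ('v, 'k) mpoly ring"
  obtain E where E: "upset V E" "U = span_mon E" using assms(1) by (auto simp: monomial_ideal_iff)
  define A where "A = {x \<in> V. \<exists>k. single x k \<in> E}"
  have "0 \<notin> E"
  proof
    assume "0 \<in> E"
    then have "u \<in> E" if "u \<in> exps V" for u using that E(1) unfolding upset_def by force
    then have "E = exps V" using E(1) by (auto simp: upset_def)
    then show False using prim by (simp add: primary_ideal_def carrier_span E(2))
  qed
  moreover have "m \<in> E" if "u \<in> exps V" "m \<in> exps V" "keys u \<inter> A = {}" "u + m \<in> E" for u m
    using that
  proof (induction "card (keys u)" arbitrary: u rule: less_induct)
    case less
    show ?case
    proof (cases "u = 0")
      case False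
      then obtain x where x: "x \<in> keys u" by fastforce
      define l where "l = lookup u x"
      define u' where "u' = u - single x l"
      have u: "u = single x l + u'"
        by (rule poly_mapping_eqI) (simp add: u'_def l_def lookup_add lookup_minus lookup_single when_def)
      have ku: "keys u' = keys u - {x}"
        by (auto simp: u'_def l_def in_keys_iff lookup_minus lookup_single when_def split: if_splits)
      have u': "u' \<in> exps V" using less.prems(1) ku by (auto simp: exps_def)
      have "x \<in> V" using x less.prems(1) by (auto simp: exps_def)
      let ?a = "monomial (u' + m) :: ('v, 'k) mpoly"
      let ?b = "monomial (single x l) :: ('v, 'k) mpoly"
      have "?a \<otimes>\<^bsub>?R\<^esub> ?b = monomial (u + m)"
        by (simp add: u mon_mult[symmetric] ac_simps)
      then have "?a \<otimes>\<^bsub>?R\<^esub> ?b \<in> U" using less.prems(4) by (simp add: E(2))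
      moreover have "?a \<in> carrier ?R" "?b \<in> carrier ?R"
        using u' less.prems(2) \<open>x \<in> V\<close> by (simp_all add: mon_in_carrier)
      ultimately have "?a \<in> U \<or> ?b \<in> radical ?R U" using prim by (simp add: primary_ideal_def)
      moreover have "?b \<notin> radical ?R U"
        using less.prems(3) x \<open>x \<in> V\<close> by (auto simp: radical_def monomial_pow E(2) A_def)
      ultimately have "u' + m \<in> E" by (simp add: E(2))
      moreover have "card (keys u') < card (keys u)"
        using x unfolding ku by (intro psubset_card_mono) auto
      ultimately show ?thesis using less.hyps[of u'] u' less.prems ku by blast
    qed (use less in simp)
  qed
  ultimately have "primary_exps V A E" using E(1) by (auto simp: primary_exps_def A_def)
  with E(2) show thesis by (rule that)
qed

section \<open>Sums of monomial ideals\<close>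

lemma finsum_mpoly_ring:
  fixes f :: "'i \<Rightarrow> ('v, 'k::field) mpoly"
  assumes "finite T" "f \<in> T \<rightarrow> carrier (mpoly_ring V)"
  shows "finsum (mpoly_ring V) f T = sum f T"
proof -
  interpret cring "mpoly_ring V :: ('v, 'k) mpoly ring" by (rule cring_mpoly_ring)
  show ?thesis using assms by (induction T) (auto simp: finsum_insert Pi_iff)
qed

lemma ideal_sum_span_mon:
  assumes T: "finite T" and U: "\<And>i. i \<in> T \<Longrightarrow> U i = span_mon (E i)" and E: "\<And>i. i \<in> T \<Longrightarrow> E i \<subseteq> exps V"
  shows "ideal_sum (mpoly_ring V) U T = (span_mon (\<Union>i \<in> T. E i) :: ('v, 'k::field) mpoly set)"
proof (intro equalityI subsetI)
  have sum_eq: "finsum (mpoly_ring V) x T = sum x T" if "x \<in> Pi T U" for x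
  proof (rule finsum_mpoly_ring[OF T])
    show "x \<in> T \<rightarrow> carrier (mpoly_ring V)"
      using that U span_mon_mono[OF E] by (fastforce simp: carrier_span)
  qed
  {
    fix p :: "('v, 'k) mpoly" assume "p \<in> ideal_sum (mpoly_ring V) U T"
    then obtain x where x: "x \<in> Pi T U" "p = sum x T" using sum_eq by (auto simp: ideal_sum_def)
    have "x i \<in> span_mon (\<Union>i \<in> T. E i)" if "i \<in> T" for i
      using that x(1) U span_mon_mono[of "E i" "\<Union>i \<in> T. E i"] by fastforce
    then show "p \<in> span_mon (\<Union>i \<in> T. E i)" unfolding x(2) by (rule span_mon_sum)
  next
    fix p :: "('v, 'k) mpoly" assume p: "p \<in> span_mon (\<Union>i \<in> T. E i)"
    \<comment> \<open>Each term of \<open>p\<close> is assigned to one component containing it;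
      collecting the terms with the same value of \<open>f\<close> gives the summands.\<close>
    then obtain f where f: "\<And>m. m \<in> keys p \<Longrightarrow> f m \<in> T \<and> m \<in> E (f m)"
      unfolding span_mon_def by simp (metis UN_iff subset_iff)
    define x where "x i = part {m. f m = i} p" for i
    have "x \<in> Pi T U" using f U by (auto simp: x_def span_mon_def)
    moreover have "sum x T = p"
    proof (rule poly_mapping_eqI)
      fix m
      show "lookup (sum x T) m = lookup p m"
        using f[of m] T by (simp add: lookup_sum x_def lookup_part in_keys_iff) blast
    qed
    ultimately show "p \<in> ideal_sum (mpoly_ring V) U T"
      using sum_eq by (force simp: ideal_sum_def)
  }
qed

section \<open>Dimension of polynomial rings and height of monomial ideals\<close>

lemma bounded_exps:
  assumes "finite V"
  shows "finite {m \<in> exps V. \<forall>y. lookup m y \<le> B}" (is "finite ?S")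
    and "card {m \<in> exps V. \<forall>y. lookup m y \<le> B} \<le> (B + 1) ^ card V"
proof -
  let ?f = "\<lambda>m. restrict (lookup m) V"
  have inj: "inj_on ?f ?S"
  proof (rule inj_onI)
    fix a b assume ab: "a \<in> ?S" "b \<in> ?S" "?f a = ?f b"
    show "a = b"
    proof (rule poly_mapping_eqI)
      fix y
      show "lookup a y = lookup b y"
      proof (cases "y \<in> V")
        case True
        then show ?thesis using fun_cong[OF ab(3), of y] by simp
      next
        case False
        then have "y \<notin> keys a" "y \<notin> keys b" using ab by (auto simp: exps_def)
        then show ?thesis by (simp add: in_keys_iff)
      qed
    qed
  qed
  have sub: "?f ` ?S \<subseteq> (\<Pi>\<^sub>E i\<in>V. {..B})" by auto
  have fin: "finite (\<Pi>\<^sub>E i\<in>V. {..B})" using assms by (intro finite_PiE) auto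
  show "finite ?S" using inj_on_finite[OF inj sub fin] .
  show "card ?S \<le> (B + 1) ^ card V"
    using card_inj_on_le[OF inj sub fin] card_PiE[OF assms, of "\<lambda>_. {..B}"] by simp
qed

text \<open>The list entries are the exponents of \<open>x s\<close>, \<open>x (s + 1)\<close> and
  so on. The starting index allows an induction that moves up the prime chain.\<close>

fun pow_prod :: "(nat \<Rightarrow> 'a::comm_monoid_mult) \<Rightarrow> nat \<Rightarrow> nat list \<Rightarrow> 'a" where
  "pow_prod x s [] = 1"
| "pow_prod x s (e # es) = x s ^ e * pow_prod x (Suc s) es"

definition exp_lists :: "nat \<Rightarrow> nat \<Rightarrow> nat list set" where
  "exp_lists D k = {es. set es \<subseteq> {..D} \<and> length es = k}"

lemma finite_exp_lists: "finite (exp_lists D k)"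
  and card_exp_lists: "card (exp_lists D k) = (D + 1) ^ k"
  unfolding exp_lists_def by (simp_all add: finite_lists_length_eq card_lists_length_eq)

lemma sum_exp_lists_Suc:
  "(\<Sum>es \<in> exp_lists D (Suc k). f es) = (\<Sum>e \<le> D. \<Sum>es \<in> exp_lists D k. f (e # es))"
proof -
  have "exp_lists D (Suc k) = (\<lambda>(e, es). e # es) ` ({..D} \<times> exp_lists D k)"
    by (auto simp: exp_lists_def length_Suc_conv image_iff)
  then have "(\<Sum>es \<in> exp_lists D (Suc k). f es) = (\<Sum>z \<in> {..D} \<times> exp_lists D k. f (case z of (e, es) \<Rightarrow> e # es))"
    by (simp add: sum.reindex inj_on_def case_prod_beta)
  then show ?thesis by (simp add: sum.cartesian_product case_prod_beta)
qed

lemma pow_prod_carrier: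
  fixes x :: "nat \<Rightarrow> ('v, 'k::field) mpoly"
  assumes "\<And>i. s \<le> i \<Longrightarrow> i < s + length es \<Longrightarrow> x i \<in> carrier (mpoly_ring V)"
  shows "pow_prod x s es \<in> carrier (mpoly_ring V)"
  using assms
proof (induction es arbitrary: s)
  interpret cring "mpoly_ring V :: ('v, 'k) mpoly ring" by (rule cring_mpoly_ring)
  case Nil
  show ?case using one_closed by simp
next
  interpret cring "mpoly_ring V :: ('v, 'k) mpoly ring" by (rule cring_mpoly_ring)
  case (Cons e es)
  have "pow_prod x (Suc s) es \<in> carrier (mpoly_ring V)" by (rule Cons.IH) (use Cons.prems in auto)
  moreover have "x s ^ e \<in> carrier (mpoly_ring V)"
    using nat_pow_closed[of "x s" e] Cons.prems[of s] by simp
  ultimately show ?case using m_closed by fastforce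
qed

lemma lookup_pow_prod_le:
  fixes x :: "nat \<Rightarrow> ('v, 'k::field) mpoly"
  assumes x: "\<And>i m y. s \<le> i \<Longrightarrow> i < s + length es \<Longrightarrow> m \<in> keys (x i) \<Longrightarrow> lookup m y \<le> d"
    and D: "set es \<subseteq> {..D}" and m: "m \<in> keys (pow_prod x s es)"
  shows "lookup m y \<le> length es * D * d"
  using assms
proof (induction es arbitrary: s m)
  case Nil
  then show ?case by simp
next
  case (Cons e es)
  obtain a b where ab: "m = a + b" "a \<in> keys (x s ^ e)" "b \<in> keys (pow_prod x (Suc s) es)"
    using subsetD[OF Poly_Mapping.keys_mult, of m "x s ^ e" "pow_prod x (Suc s) es"] Cons.prems(3) by auto
  have "lookup a y \<le> e * d" using ab(2)
  proof (induction e arbitrary: a)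
    case (Suc e)
    obtain a1 a2 where "a = a1 + a2" "a1 \<in> keys (x s)" "a2 \<in> keys (x s ^ e)"
      using subsetD[OF Poly_Mapping.keys_mult, of a "x s" "x s ^ e"] Suc.prems by auto
    moreover from this have "lookup a1 y \<le> d" using Cons.prems(1)[of s] by simp
    ultimately show ?case using Suc.IH[of a2] by (simp add: lookup_add)
  qed simp
  moreover have "e * d \<le> D * d" using Cons.prems(2) by simp
  moreover have "lookup b y \<le> length es * D * d"
  proof (rule Cons.IH[OF _ _ ab(3)])
    show "lookup m y \<le> d" if "Suc s \<le> i" "i < Suc s + length es" "m \<in> keys (x i)" for i m y
      using that by (intro Cons.prems(1)[of i]) auto
  qed (use Cons.prems in auto)
  ultimately have "lookup a y + lookup b y \<le> D * d + length es * D * d" by linarith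
  then show ?case by (simp add: ab(1) lookup_add distrib_right)
qed

text \<open>Peel off the lowest power of \<open>x s\<close> with a nonzero coefficient; modulo the next prime of the
  chain only that coefficient remains.\<close>

lemma prime_chain_independent:
  fixes C :: "nat \<Rightarrow> ('v, 'k::field) mpoly set"
  assumes C: "\<And>i. i \<le> r \<Longrightarrow> primeideal (C i) (mpoly_ring V)"
    and x: "\<And>i. i < r \<Longrightarrow> x i \<in> C (Suc i)" "\<And>i. i < r \<Longrightarrow> x i \<notin> C i"
    and sub: "\<And>i. i < r \<Longrightarrow> C i \<subseteq> C (Suc i)"
    and "s + k = r" "\<exists>es \<in> exp_lists D k. c es \<noteq> 0"
  shows "(\<Sum>es \<in> exp_lists D k. single 0 (c es) * pow_prod x s es) \<notin> C s"
  using assms(5,6)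
proof (induction k arbitrary: s c)
  let ?R = "mpoly_ring V :: ('v, 'k) mpoly ring"
  case 0
  interpret P: primeideal "C s" ?R using C 0 by simp
  have L: "exp_lists D 0 = {[]}" by (auto simp: exp_lists_def)
  then have c: "c [] \<noteq> 0" using 0 by simp
  show ?case
  proof
    assume "(\<Sum>es \<in> exp_lists D 0. single 0 (c es) * pow_prod x s es) \<in> C s"
    then have "single 0 (inverse (c [])) \<otimes>\<^bsub>?R\<^esub> single 0 (c []) \<in> C s"
      by (intro P.I_l_closed) (auto simp: L carrier_span single_in_span)
    then have "\<one>\<^bsub>?R\<^esub> \<in> C s" using c by (simp add: mult_single)
    then show False using P.one_imp_carrier P.I_notcarr by blast
  qed
next
  let ?R = "mpoly_ring V :: ('v, 'k) mpoly ring"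
  case (Suc k)
  then have s: "s < r" by simp
  interpret P: primeideal "C s" ?R using C s by simp
  interpret Q: primeideal "C (Suc s)" ?R using C s by simp
  have xc: "x i \<in> carrier ?R" if "i < r" for i
    using x(1)[OF that] ideal.Icarr[OF primeideal.axioms(1)[OF C[of "Suc i"]]] that by simp
  define S where "S e = (\<Sum>es \<in> exp_lists D k. single 0 (c (e # es)) * pow_prod x (Suc s) es)" for e
  have sum_carrier: "sum f A \<in> carrier ?R" if "\<And>i. i \<in> A \<Longrightarrow> f i \<in> carrier ?R"
    for f :: "'i \<Rightarrow> ('v, 'k) mpoly" and A
    using that unfolding carrier_span by (rule span_mon_sum)
  have Sc: "S e \<in> carrier ?R" for e
    unfolding S_def
  proof (rule sum_carrier)
    fix es assume "es \<in> exp_lists D k"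
    then have "pow_prod x (Suc s) es \<in> carrier ?R"
      using Suc.prems(1) by (intro pow_prod_carrier xc) (auto simp: exp_lists_def)
    moreover have "single 0 (c (e # es)) \<in> carrier ?R" by (simp add: carrier_span single_in_span)
    ultimately show "single 0 (c (e # es)) * pow_prod x (Suc s) es \<in> carrier ?R"
      using P.m_closed by fastforce
  qed
  let ?nz = "\<lambda>e. e \<le> D \<and> (\<exists>es \<in> exp_lists D k. c (e # es) \<noteq> 0)"
  obtain es0 where "es0 \<in> exp_lists D (Suc k)" "c es0 \<noteq> 0" using Suc.prems by blast
  then have "?nz (hd es0)"
    by (cases es0) (auto simp: exp_lists_def intro!: bexI[of _ "tl es0"])
  then obtain m where m: "?nz m" and m_least: "\<And>e. e < m \<Longrightarrow> \<not> ?nz e"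
    using exists_least_iff[of ?nz] by blast
  \<comment> \<open>The summands with exponent above \<open>m\<close> are divisible by
    \<open>x s ^ (m + 1)\<close>, and \<open>H\<close> is the cofactor of their sum.\<close>
  define H where "H = (\<Sum>e \<in> {m<..D}. x s ^ (e - m - 1) * S e)"
  have pc: "x s ^ n \<in> carrier ?R" for n using P.nat_pow_closed[OF xc[OF s], of n] by simp
  have Hc: "H \<in> carrier ?R"
    unfolding H_def using P.m_closed[OF pc Sc] by (intro sum_carrier) simp
  have "(\<Sum>es \<in> exp_lists D (Suc k). single 0 (c es) * pow_prod x s es) = (\<Sum>e \<le> D. x s ^ e * S e)"
    by (simp add: sum_exp_lists_Suc S_def sum_distrib_left ac_simps)
  also have "\<dots> = (\<Sum>e \<in> {m..D}. x s ^ e * S e)"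
  proof (rule sum.mono_neutral_right)
    have "S e = 0" if "e \<le> D" "e < m" for e
      using m_least[OF that(2)] that(1) by (simp add: S_def)
    then show "\<forall>e \<in> {..D} - {m..D}. x s ^ e * S e = 0" by auto
  qed auto
  also have "\<dots> = x s ^ m * S m + (\<Sum>e \<in> {m<..D}. x s ^ e * S e)"
    using m by (subst sum.head) auto
  also have "(\<Sum>e \<in> {m<..D}. x s ^ e * S e) = x s ^ m * (x s * H)"
    unfolding H_def sum_distrib_left
  proof (intro sum.cong refl)
    fix e assume "e \<in> {m<..D}"
    then have "x s ^ e = x s ^ (m + 1 + (e - m - 1))" by simp
    then have "x s ^ e = x s ^ m * (x s * x s ^ (e - m - 1))" by (simp only: power_add power_one_right mult.assoc)
    then show "x s ^ e * S e = x s ^ m * (x s * (x s ^ (e - m - 1) * S e))" by (simp add: mult.assoc)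
  qed
  finally have eq: "(\<Sum>es \<in> exp_lists D (Suc k). single 0 (c es) * pow_prod x s es)
      = x s ^ m * (S m + x s * H)" by (simp add: distrib_left)
  \<comment> \<open>By the induction hypothesis \<open>S m\<close> avoids the next prime, which
    contains \<open>x s * H\<close>. So the factor \<open>S m + x s * H\<close> avoids
    \<open>C (Suc s)\<close> and its subset \<open>C s\<close>; the powers of \<open>x s\<close>
    avoid the prime \<open>C s\<close> too.\<close>
  have "S m \<notin> C (Suc s)" unfolding S_def by (rule Suc.IH) (use Suc.prems m in auto)
  have "x s * H \<in> C (Suc s)" using Q.I_r_closed[OF x(1)[OF s] Hc] by simp
  have "S m + x s * H \<notin> C (Suc s)"
  proof
    assume "S m + x s * H \<in> C (Suc s)"
    moreover have "\<ominus>\<^bsub>?R\<^esub> (x s * H) \<in> C (Suc s)" using \<open>x s * H \<in> C (Suc s)\<close> by simp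
    ultimately have "(S m + x s * H) \<oplus>\<^bsub>?R\<^esub> (\<ominus>\<^bsub>?R\<^esub> (x s * H)) \<in> C (Suc s)"
      by (rule additive_subgroup.a_closed[OF Q.additive_subgroup_axioms])
    then show False
      using \<open>S m \<notin> C (Suc s)\<close> a_inv_mpoly_ring[OF Q.Icarr[OF \<open>x s * H \<in> C (Suc s)\<close>]] by simp
  qed
  then have "S m + x s * H \<notin> C s" using sub[OF s] by blast
  moreover have "x s ^ n \<notin> C s" for n
  proof (induction n)
    case 0
    show ?case using P.one_imp_carrier P.I_notcarr by auto
  next
    case (Suc n)
    then show ?case using P.I_prime[OF xc[OF s] pc] x(2)[OF s] by fastforce
  qed
  moreover have "S m + x s * H \<in> carrier ?R"
    using P.a_closed[OF Sc P.m_closed[OF xc[OF s] Hc]] by simp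
  ultimately have "x s ^ m \<otimes>\<^bsub>?R\<^esub> (S m + x s * H) \<notin> C s" using P.I_prime[OF pc] by blast
  then show ?case unfolding eq by simp
qed

text \<open>In a chain longer than the number of variables the power products with exponents at most \<open>D\<close>
  outnumber, for large \<open>D\<close>, the monomials that can occur in them.\<close>

lemma prime_chain_length:
  fixes C :: "nat \<Rightarrow> ('v, 'k::field) mpoly set"
  assumes V: "finite V"
    and C: "\<And>i. i \<le> r \<Longrightarrow> primeideal (C i) (mpoly_ring V)"
    and sub: "\<And>i. i < r \<Longrightarrow> C i \<subset> C (Suc i)"
  shows "r \<le> card V"
proof (rule ccontr)
  assume "\<not> ?thesis"
  then have r: "card V + 1 \<le> r" by simp
  let ?R = "mpoly_ring V :: ('v, 'k) mpoly ring"
  let ?scale = "\<lambda>a p. single 0 a * p :: ('v, 'k) mpoly"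
  interpret vs: vector_space ?scale
    by unfold_locales (simp_all add: distrib_left distrib_right single_add mult_single flip: mult.assoc)
  obtain x where x: "\<And>i. i < r \<Longrightarrow> x i \<in> C (Suc i)" "\<And>i. i < r \<Longrightarrow> x i \<notin> C i"
  proof -
    have "\<forall>i. \<exists>y. i < r \<longrightarrow> y \<in> C (Suc i) \<and> y \<notin> C i" using sub by blast
    then show thesis using that by metis
  qed
  have xc: "x i \<in> carrier ?R" if "i < r" for i
    using x(1)[OF that] ideal.Icarr[OF primeideal.axioms(1)[OF C[of "Suc i"]]] that by simp
  define W where "W = (\<Union>i<r. \<Union>m \<in> keys (x i). lookup m ` keys m)"
  \<comment> \<open>The inserted 0 keeps the maximum defined when \<open>W\<close> is empty.\<close>
  define d where "d = Max (insert 0 W)"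
  have "finite W" by (simp add: W_def)
  have d: "lookup m y \<le> d" if "i < r" "m \<in> keys (x i)" for i m y
  proof (cases "y \<in> keys m")
    case True
    then have "lookup m y \<in> W" using that by (auto simp: W_def)
    then show ?thesis using \<open>finite W\<close> by (simp add: d_def)
  qed (simp add: in_keys_iff)
  \<comment> \<open>Since \<open>B + 1 \<le> K * (D + 1)\<close>, at most
    \<open>K ^ card V * (D + 1) ^ card V\<close> monomials are available. With
    \<open>D = K ^ card V\<close> this is \<open>D * (D + 1) ^ card V\<close>, which is less than
    the number \<open>(D + 1) ^ r\<close> of exponent lists.\<close>
  define K where "K = r * d + 1"
  define D where "D = K ^ card V"
  define B where "B = r * D * d"
  let ?M = "pow_prod x 0"
  let ?T = "(\<lambda>m. single m (1::'k)) ` {m \<in> exps V. \<forall>y. lookup m y \<le> B}"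
  have finT: "finite ?T" using bounded_exps(1)[OF V] by simp
  have "card ?T \<le> (B + 1) ^ card V"
    using card_image_le[OF bounded_exps(1)[OF V]] bounded_exps(2)[OF V] order_trans by blast
  also have "\<dots> \<le> (K * (D + 1)) ^ card V"
    by (intro power_mono) (simp_all add: B_def K_def algebra_simps)
  also have "\<dots> = D * (D + 1) ^ card V" by (simp only: power_mult_distrib D_def)
  also have "\<dots> < (D + 1) ^ (card V + 1)" by simp
  also have "\<dots> \<le> (D + 1) ^ r" using r by (intro power_increasing) auto
  finally have lt: "card ?T < card (exp_lists D r)" by (simp add: card_exp_lists)
  have span: "?M es \<in> vs.span ?T" if es: "es \<in> exp_lists D r" for es
  proof -
    have "single m (1::'k) \<in> ?T" if m: "m \<in> keys (?M es)" for m
    proof -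
      have "lookup m y \<le> B" for y
        using lookup_pow_prod_le[of 0 es x d D m y] es d m by (auto simp: exp_lists_def B_def)
      moreover have "m \<in> exps V"
        using pow_prod_carrier[of 0 es x V] es xc m by (auto simp: exp_lists_def carrier_span span_mon_def)
      ultimately show ?thesis by blast
    qed
    then have "(\<Sum>m \<in> keys (?M es). single 0 (lookup (?M es) m) * single m 1) \<in> vs.span ?T"
      by (intro vs.span_sum vs.span_scale vs.span_base)
    moreover have "(\<Sum>m \<in> keys (?M es). single 0 (lookup (?M es) m) * single m 1) = part UNIV (?M es)"
      by (simp add: part_def mult_single)
    moreover have "part UNIV (?M es) = ?M es" by (rule poly_mapping_eqI) (simp add: lookup_part)
    ultimately show ?thesis by simp
  qed
  have "\<exists>c. (\<exists>es \<in> exp_lists D r. c es \<noteq> 0) \<and> (\<Sum>es \<in> exp_lists D r. single 0 (c es) * ?M es) = 0"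
  proof (cases "inj_on ?M (exp_lists D r)")
    case True
    have "vs.dependent (?M ` exp_lists D r)"
    proof (rule ccontr)
      assume "vs.independent (?M ` exp_lists D r)"
      moreover have "?M ` exp_lists D r \<subseteq> vs.span ?T" using span by blast
      ultimately have "card (?M ` exp_lists D r) \<le> card ?T"
        using vs.independent_span_bound[OF finT] by blast
      then show False using lt by (simp only: card_image[OF True])
    qed
    then obtain u where u: "\<exists>v \<in> ?M ` exp_lists D r. u v \<noteq> 0"
        "(\<Sum>v \<in> ?M ` exp_lists D r. single 0 (u v) * v) = 0"
      unfolding vs.dependent_finite[OF finite_imageI[OF finite_exp_lists]] by blast
    have "(\<Sum>es \<in> exp_lists D r. single 0 (u (?M es)) * ?M es) = 0"
      using u(2) by (simp add: sum.reindex[OF True])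
    with u(1) show ?thesis by (intro exI[of _ "\<lambda>es. u (?M es)"]) blast
  next
    case False
    \<comment> \<open>Dependence of a set does not see coincidences among its members; two equal
      power products give a relation with coefficients 1 and -1.\<close>
    then obtain e1 e2 where e: "e1 \<in> exp_lists D r" "e2 \<in> exp_lists D r" "?M e1 = ?M e2" "e1 \<noteq> e2"
      by (auto simp: inj_on_def)
    let ?c = "\<lambda>es. if es = e1 then 1 else if es = e2 then - 1 else (0::'k)"
    have "(\<Sum>es \<in> exp_lists D r. single 0 (?c es) * ?M es) = (\<Sum>es \<in> {e1, e2}. single 0 (?c es) * ?M es)"
      using e finite_exp_lists by (intro sum.mono_neutral_right) auto
    also have "\<dots> = 0" using e by (simp add: single_uminus)
    finally show ?thesis using e(1) by (intro exI[of _ ?c]) auto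
  qed
  then obtain c where c: "\<exists>es \<in> exp_lists D r. c es \<noteq> 0"
      "(\<Sum>es \<in> exp_lists D r. single 0 (c es) * ?M es) = 0" by blast
  have "(\<Sum>es \<in> exp_lists D r. single 0 (c es) * ?M es) \<notin> C 0"
    by (rule prime_chain_independent[of r C V x]) (use C x psubset_imp_subset[OF sub] c in auto)
  moreover have "0 \<in> C 0"
    using additive_subgroup.zero_closed[OF ideal.axioms(1)[OF primeideal.axioms(1)[OF C[of 0]]]] by simp
  ultimately show False using c(2) by simp
qed

section \<open>Primes generated by variables and their heights\<close>

lemma primeideal_meets:
  fixes V :: "'v::linorder set"
  assumes "finite A"
  shows "primeideal (span_mon (meets V A) :: ('v, 'k::field) mpoly set) (mpoly_ring V)"
proof (rule primeidealI)
  let ?R = "mpoly_ring V :: ('v, 'k) mpoly ring"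
  show "carrier ?R \<noteq> span_mon (meets V A)"
  proof -
    have "(1 :: ('v, 'k) mpoly) \<in> carrier ?R" by (simp add: carrier_span span_mon_def)
    moreover have "(1 :: ('v, 'k) mpoly) \<notin> span_mon (meets V A)" by (rule one_notin_meets)
    ultimately show ?thesis by blast
  qed
  show "a \<in> span_mon (meets V A) \<or> b \<in> span_mon (meets V A)"
    if "a \<in> carrier ?R" "b \<in> carrier ?R" "a \<otimes>\<^bsub>?R\<^esub> b \<in> span_mon (meets V A)" for a b
    using that by (intro span_mon_mult_cases[OF assms upset_meets meets_cancel]) simp_all
qed (rule ideal_span_mon[OF upset_meets] cring_mpoly_ring)+

lemma span_meets_strict:
  assumes "x \<in> V" "x \<notin> A"
  shows "span_mon (meets V A) \<subset> (span_mon (meets V (insert x A)) :: ('v, 'k::field) mpoly set)"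
proof -
  have "single x 1 \<in> meets V (insert x A)" "single x 1 \<notin> meets V A" "meets V A \<subseteq> meets V (insert x A)"
    using assms by (auto simp: meets_def)
  then show ?thesis by (metis psubsetI span_mon_inject span_mon_mono)
qed

lemma enumerate_finite:
  assumes "finite W"
  obtains f where "W = f ` {..<card W}" "inj_on f {..<card W}"
  using ex_bij_betw_nat_finite[OF assms] by (auto simp: bij_betw_def atLeast0LessThan)

text \<open>Adjoining the variables of \<open>W\<close> one at a time to the zero ideal gives a
  strict chain of primes with \<open>card W\<close> steps; replacing its last member by the larger
  prime \<open>P\<close> keeps it strict.\<close>

lemma height_prime_ge:
  fixes V :: "'v::linorder set" and P :: "('v, 'k::field) mpoly set"
  assumes V: "finite V" and W: "W \<subseteq> V" and P: "primeideal P (mpoly_ring V)" "span_mon (meets V W) \<subseteq> P"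
  shows "enat (card W) \<le> height_prime (mpoly_ring V) P"
proof -
  have "finite W" using V W by (rule finite_subset[rotated])
  then obtain f where f: "W = f ` {..<card W}" "inj_on f {..<card W}" by (rule enumerate_finite)
  define C where "C i = (if i < card W then span_mon (meets V (f ` {..<i})) else P)" for i
  have "primeideal (C i) (mpoly_ring V)" for i
    using P(1) by (simp add: C_def primeideal_meets)
  moreover have "C i \<subset> C (Suc i)" if i: "i < card W" for i
  proof -
    have "f i \<in> V" using f(1) W i by blast
    moreover have "f i \<notin> f ` {..<i}" using inj_on_image_mem_iff[OF f(2), of i "{..<i}"] i by auto
    ultimately have "C i \<subset> span_mon (meets V (insert (f i) (f ` {..<i})))"
      using span_meets_strict i by (simp add: C_def)
    also have "insert (f i) (f ` {..<i}) = f ` {..<Suc i}" by (auto simp: lessThan_Suc)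
    also have "span_mon (meets V (f ` {..<Suc i})) \<subseteq> C (Suc i)"
      using f(1) P(2) i by (cases "Suc i = card W") (auto simp: C_def)
    finally show ?thesis .
  qed
  moreover have "C (card W) = P" by (simp add: C_def)
  ultimately show ?thesis unfolding height_prime_def by (intro Sup_upper) blast
qed

text \<open>Any chain below the prime generated by the variables in \<open>W\<close> can be continued by adjoining the
  remaining variables.\<close>

lemma height_prime_meets:
  fixes V :: "'v::linorder set"
  assumes V: "finite V" and W: "W \<subseteq> V"
  shows "height_prime (mpoly_ring V) (span_mon (meets V W) :: ('v, 'k::field) mpoly set) = enat (card W)"
proof (rule antisym)
  have fin: "finite W" using V W by (rule finite_subset[rotated])
  show "enat (card W) \<le> height_prime (mpoly_ring V) (span_mon (meets V W) :: ('v, 'k) mpoly set)"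
    using V W primeideal_meets[OF fin] by (intro height_prime_ge) auto
  show "height_prime (mpoly_ring V) (span_mon (meets V W) :: ('v, 'k) mpoly set) \<le> enat (card W)"
    unfolding height_prime_def
  proof (rule Sup_least, clarify)
    fix r :: nat and C :: "nat \<Rightarrow> ('v, 'k) mpoly set"
    assume C: "\<forall>i\<le>r. primeideal (C i) (mpoly_ring V)" "\<forall>i<r. C i \<subset> C (Suc i)"
      "C r = span_mon (meets V W)"
    obtain f where f: "V - W = f ` {..<card (V - W)}" "inj_on f {..<card (V - W)}"
      by (rule enumerate_finite[OF finite_Diff[OF V]])
    \<comment> \<open>Both branches describe the same prime at \<open>i = r\<close>, where the given
      chain ends and the adjoining of variables from \<open>V - W\<close> begins.\<close>
    define D where "D i = (if i \<le> r then C i else span_mon (meets V (W \<union> f ` {..<i - r})))" for i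
    have "r + card (V - W) \<le> card V"
    proof (rule prime_chain_length[OF V, of _ D])
      show "primeideal (D i) (mpoly_ring V)" for i
        using C(1) fin by (simp add: D_def primeideal_meets)
      show "D i \<subset> D (Suc i)" if i: "i < r + card (V - W)" for i
      proof (cases "i < r")
        case True
        then show ?thesis using C(2) by (simp add: D_def)
      next
        case False
        define j where "j = i - r"
        have j: "i = r + j" "j < card (V - W)" using i False by (auto simp: j_def)
        then have fj: "f j \<in> V - W" using f(1) by blast
        moreover have "f j \<notin> f ` {..<j}" using inj_on_image_mem_iff[OF f(2), of j "{..<j}"] j by auto
        ultimately have "span_mon (meets V (W \<union> f ` {..<j})) \<subset>
            (span_mon (meets V (insert (f j) (W \<union> f ` {..<j}))) :: ('v, 'k) mpoly set)"
          by (intro span_meets_strict) auto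
        moreover have "D i = span_mon (meets V (W \<union> f ` {..<j}))"
          using C(3) by (cases j) (simp_all add: D_def j(1))
        moreover have "insert (f j) (W \<union> f ` {..<j}) = W \<union> f ` {..<Suc j}" by (auto simp: lessThan_Suc)
        ultimately show ?thesis by (simp add: D_def j(1))
      qed
    qed
    moreover have "card (V - W) = card V - card W" "card W \<le> card V"
      using V W by (auto simp: card_Diff_subset fin card_mono)
    ultimately show "enat r \<le> enat (card W)" by simp
  qed
qed

text \<open>A prime containing a power of each variable in \<open>W\<close> contains these
  variables, hence the prime they generate. That prime itself contains \<open>span_mon E\<close>, so
  it attains the infimum.\<close>

lemma height_span_mon:
  fixes V :: "'v::linorder set"
  assumes V: "finite V" and W: "W \<subseteq> V" and E: "E \<subseteq> meets V W"
    and pow: "\<forall>x \<in> W. \<exists>k. single x k \<in> E"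
  shows "height (mpoly_ring V) (span_mon E :: ('v, 'k::field) mpoly set) = enat (card W)"
proof (rule antisym)
  let ?R = "mpoly_ring V :: ('v, 'k) mpoly ring"
  have fin: "finite W" using V W by (rule finite_subset[rotated])
  show "height ?R (span_mon E) \<le> enat (card W)"
    unfolding height_def height_prime_meets[OF V W, where ?'k = 'k, symmetric]
    using primeideal_meets[OF fin] span_mon_mono[OF E] by (intro Inf_lower) blast
  show "enat (card W) \<le> height ?R (span_mon E)"
    unfolding height_def
  proof (rule Inf_greatest, clarify)
    fix P assume P: "primeideal P ?R" "span_mon E \<subseteq> P"
    interpret primeideal P ?R by fact
    have var: "monomial (single x 1) \<in> P" if x: "x \<in> W" for x
    proof -
      obtain k where "single x k \<in> E" using pow x by blast
      then have "monomial (single x (k * 1)) \<in> P" using P(2) monomial_in_span by fastforce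
      then have "monomial (single x 1) ^ k \<in> P" by (simp only: monomial_pow)
      then show ?thesis
      proof (induction k)
        case 0
        then show ?case using one_imp_carrier I_notcarr by simp
      next
        case (Suc k)
        have c: "monomial (single x 1) \<in> carrier ?R" using x W by (auto simp: mon_in_carrier)
        show ?case
          using I_prime[OF c, of "monomial (single x 1) ^ k"] nat_pow_closed[OF c, of k] Suc by auto
      qed
    qed
    have "span_mon (meets V W) \<subseteq> P"
    proof (rule ideal_contains_span)
      fix m assume "m \<in> meets V W"
      then obtain x where x: "x \<in> keys m" "x \<in> W" and m: "m \<in> exps V" by (auto simp: meets_def)
      have "mon_dvd (single x 1) m"
        using x(1) by (auto simp: mon_dvd_def lookup_single when_def in_keys_iff)
      then obtain d where d: "m = d + single x 1" by (auto simp: mon_dvd_iff)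
      then have "d \<in> exps V" using m by simp
      then have "monomial d \<otimes>\<^bsub>?R\<^esub> monomial (single x 1) \<in> P"
        using var[OF x(2)] by (intro I_l_closed) (simp_all add: mon_in_carrier)
      then show "monomial m \<in> P" by (simp add: d mon_mult)
    qed (use is_ideal in \<open>auto simp: meets_def\<close>)
    then show "enat (card W) \<le> height_prime ?R P" by (rule height_prime_ge[OF V W P(1)])
  qed
qed

section \<open>Associated primes and the size\<close>

text \<open>The sets \<open>A\<close> of variables such that the prime generated by \<open>A\<close> is the annihilator of a monomial
  modulo the ideal.\<close>

definition assoc_sets :: "'v set \<Rightarrow> ('v \<Rightarrow>\<^sub>0 nat) set \<Rightarrow> 'v set set" where
  "assoc_sets V E = {A. A \<subseteq> V \<and> (\<exists>m \<in> exps V. \<forall>w \<in> exps V. w + m \<in> E \<longleftrightarrow> keys w \<inter> A \<noteq> {})}"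

lemma meets_mono: "A \<subseteq> B \<Longrightarrow> meets V A \<subseteq> meets V B"
  by (auto simp: meets_def)

lemma upset_addI: "upset V E \<Longrightarrow> m \<in> E \<Longrightarrow> u \<in> exps V \<Longrightarrow> u + m \<in> E"
  by (simp add: upset_def)

lemma upset_dvd:
  assumes "upset V E" "u \<in> E" "mon_dvd u w" "w \<in> exps V"
  shows "w \<in> E"
  using assms by (auto simp: mon_dvd_iff intro: upset_addI)

text \<open>Among the monomials \<open>u\<close> keeping \<open>u + m\<close> outside
  \<open>E\<close>, one of largest degree in \<open>A\<close> is taken; the degree is bounded
  because \<open>E\<close> contains powers of the variables in \<open>A\<close>. Any further
  variable of \<open>A\<close> then leads into \<open>E\<close>, while factors free of
  \<open>A\<close> can be cancelled.\<close>

lemma primary_exps_assoc_witness: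
  assumes V: "finite V" and E: "primary_exps V A E" and m: "m \<in> exps V" "m \<notin> E"
  obtains u where "u \<in> exps V" "\<And>w. w \<in> exps V \<Longrightarrow> w + (u + m) \<in> E \<longleftrightarrow> keys w \<inter> A \<noteq> {}"
proof -
  have up: "upset V E" and AV: "A \<subseteq> V" and pow: "\<forall>x \<in> A. \<exists>k. single x k \<in> E"
    and cancel: "\<And>u m. u \<in> exps V \<Longrightarrow> m \<in> exps V \<Longrightarrow> keys u \<inter> A = {} \<Longrightarrow> u + m \<in> E \<Longrightarrow> m \<in> E"
    using E unfolding primary_exps_def by blast+
  obtain k where k: "\<And>x. x \<in> A \<Longrightarrow> single x (k x) \<in> E" using pow by metis
  have fin: "finite A" using V AV by (rule finite_subset[rotated])
  define deg where "deg u = (\<Sum>x \<in> A. lookup u x)" for u :: "'a \<Rightarrow>\<^sub>0 nat"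
  let ?P = "\<lambda>u. u \<in> exps V \<and> u + m \<notin> E"
  have bound: "deg u \<le> sum k A" if u: "?P u" for u
    unfolding deg_def
  proof (rule sum_mono, rule ccontr)
    fix x assume x: "x \<in> A" "\<not> lookup u x \<le> k x"
    have "mon_dvd (single x (k x)) (u + m)"
      using x(2) by (auto simp: mon_dvd_def lookup_single lookup_add when_def)
    then have "u + m \<in> E" using upset_dvd[OF up k[OF x(1)], of "u + m"] u m(1) by simp
    then show False using u by blast
  qed
  have "?P 0" using m by simp
  then obtain u where u: "?P u" and max: "\<And>v. ?P v \<Longrightarrow> deg v \<le> deg u"
    using ex_has_greatest_nat[of ?P 0 deg "Suc (sum k A)"] bound by (metis less_Suc_eq_le)
  have "w + (u + m) \<in> E \<longleftrightarrow> keys w \<inter> A \<noteq> {}" if w: "w \<in> exps V" for w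
  proof
    assume "w + (u + m) \<in> E"
    then show "keys w \<inter> A \<noteq> {}" using cancel[OF w, of "u + m"] u m by auto
  next
    assume "keys w \<inter> A \<noteq> {}"
    then obtain x where x: "x \<in> keys w" "x \<in> A" by blast
    have "deg (w + u) = deg w + deg u" by (simp add: deg_def lookup_add sum.distrib)
    moreover have "deg w > 0" using x fin by (auto simp: deg_def in_keys_iff sum_pos2)
    ultimately have "\<not> ?P (w + u)" using max[of "w + u"] by auto
    then show "w + (u + m) \<in> E" using w u by (simp add: add.assoc)
  qed
  with u show thesis by (intro that) auto
qed

text \<open>Monomial form of the first uniqueness theorem for primary decompositions. A monomial
  outside \<open>E i\<close> alone leads to \<open>A i\<close>. Conversely, a set \<open>B\<close>
  belonging to \<open>m\<close> lies in \<open>A i\<close> whenever \<open>m \<notin> E i\<close>.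
  If all these inclusions were proper, powers of variables from the sets \<open>A i - B\<close>
  would multiply to a monomial free of \<open>B\<close> that carries \<open>m\<close> into the
  intersection.\<close>

lemma assoc_sets_decomp:
  assumes V: "finite V" and I: "finite I" and prim: "\<And>i. i \<in> I \<Longrightarrow> primary_exps V (A i) (E i)"
    and irr: "\<And>i. i \<in> I \<Longrightarrow> \<exists>m \<in> exps V. m \<notin> E i \<and> (\<forall>j \<in> I - {i}. m \<in> E j)"
  shows "assoc_sets V (\<Inter>i \<in> I. E i) = A ` I"
proof (intro equalityI subsetI)
  have up: "upset V (E i)" "A i \<subseteq> V" if "i \<in> I" for i using prim[OF that] by (auto simp: primary_exps_def)
  {
    fix B assume "B \<in> A ` I"
    then obtain i where i: "i \<in> I" "B = A i" by blast
    obtain m where m: "m \<in> exps V" "m \<notin> E i" "\<forall>j \<in> I - {i}. m \<in> E j" using irr[OF i(1)] by blast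
    obtain u where u: "u \<in> exps V" and eq: "\<And>w. w \<in> exps V \<Longrightarrow> w + (u + m) \<in> E i \<longleftrightarrow> keys w \<inter> A i \<noteq> {}"
      using primary_exps_assoc_witness[OF V prim[OF i(1)] m(1,2)] by metis
    have "w + (u + m) \<in> (\<Inter>i \<in> I. E i) \<longleftrightarrow> keys w \<inter> A i \<noteq> {}" if w: "w \<in> exps V" for w
    proof -
      have "w + (u + m) \<in> E j" if "j \<in> I - {i}" for j
        using that m(3) up(1)[of j] u w by (simp add: upset_addI)
      then show ?thesis using eq[OF w] i(1) by blast
    qed
    moreover have "u + m \<in> exps V" using u m by simp
    ultimately show "B \<in> assoc_sets V (\<Inter>i \<in> I. E i)"
      using up(2)[OF i(1)] i(2) unfolding assoc_sets_def by blast
  next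
    fix B assume "B \<in> assoc_sets V (\<Inter>i \<in> I. E i)"
    then obtain m where B: "B \<subseteq> V" and m: "m \<in> exps V"
      and eq: "\<And>w. w \<in> exps V \<Longrightarrow> w + m \<in> (\<Inter>i \<in> I. E i) \<longleftrightarrow> keys w \<inter> B \<noteq> {}"
      by (auto simp: assoc_sets_def)
    have sub: "B \<subseteq> A i" if i: "i \<in> I" "m \<notin> E i" for i
    proof
      fix x assume x: "x \<in> B"
      then have "single x 1 + m \<in> E i" using eq[of "single x 1"] B i(1) by auto
      moreover have "single x 1 \<in> exps V" using x B by auto
      ultimately have "\<not> keys (single x (1::nat)) \<inter> A i = {}"
        using prim[OF i(1)] i(2) m unfolding primary_exps_def by blast
      then show "x \<in> A i" by simp
    qed
    show "B \<in> A ` I"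
    proof (rule ccontr)
      assume "B \<notin> A ` I"
      then have "\<forall>i. \<exists>x. i \<in> I \<and> m \<notin> E i \<longrightarrow> x \<in> A i - B" using sub by blast
      then obtain x where x: "\<And>i. i \<in> I \<Longrightarrow> m \<notin> E i \<Longrightarrow> x i \<in> A i - B" by metis
      let ?J = "{i \<in> I. m \<notin> E i}"
      have "\<forall>i \<in> ?J. \<exists>k. single (x i) k \<in> E i" using x prim unfolding primary_exps_def by blast
      then obtain k where k: "\<And>i. i \<in> ?J \<Longrightarrow> single (x i) (k i) \<in> E i" by metis
      define w where "w = (\<Sum>i \<in> ?J. single (x i) (k i))"
      have wV: "w \<in> exps V"
        using keys_sum[of "\<lambda>i. single (x i) (k i)" ?J] x up(2)
        by (fastforce simp: w_def exps_def split: if_splits)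
      have "w + m \<in> E i" if i: "i \<in> I" for i
      proof (cases "m \<in> E i")
        case True
        then show ?thesis using up(1)[OF i] wV by (intro upset_addI)
      next
        case False
        then have iJ: "i \<in> ?J" using i by blast
        have "w = single (x i) (k i) + (\<Sum>i \<in> ?J - {i}. single (x i) (k i))"
          unfolding w_def using I iJ by (intro sum.remove) auto
        then have "mon_dvd (single (x i) (k i)) (w + m)" by (simp add: mon_dvd_def lookup_add)
        then show ?thesis using upset_dvd[OF up(1)[OF i] k[OF iJ]] wV m by simp
      qed
      moreover have "keys w \<inter> B = {}"
        using keys_sum[of "\<lambda>i. single (x i) (k i)" ?J] x
        by (fastforce simp: w_def split: if_splits)
      ultimately show False using eq[OF wV] by blast
    qed
  }
qed

text \<open>A set of sets forgets how often a radical occurs. The condition \<open>t \<ge> 1\<close>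
  matches \<open>cover_number\<close> and matters for \<open>F = {{}}\<close>, which belongs to the
  zero ideal.\<close>

definition cov :: "'v set set \<Rightarrow> nat" where
  "cov F = (LEAST t. t \<ge> 1 \<and> (\<exists>G \<subseteq> F. card G = t \<and> \<Union>G = \<Union>F))"

lemma Least_eqI:
  fixes P Q :: "nat \<Rightarrow> bool"
  assumes "P t0" and PQ: "\<And>t. P t \<Longrightarrow> \<exists>t' \<le> t. Q t'" and QP: "\<And>t. Q t \<Longrightarrow> \<exists>t' \<le> t. P t'"
  shows "Least P = Least Q"
proof (rule antisym)
  have P: "P (Least P)" using assms(1) by (rule LeastI)
  then obtain t where "t \<le> Least P" "Q t" using PQ by blast
  then show "Least Q \<le> Least P" using Least_le[of Q t] by simp
  have "Q (Least Q)" using \<open>Q t\<close> by (rule LeastI)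
  then show "Least P \<le> Least Q" using QP Least_le[of P] order_trans by blast
qed

text \<open>Passing from indices to their sets \<open>A i\<close> can only lower the count, and a
  family of such sets lifts, with the same count, to indices on which \<open>A\<close> is
  injective.\<close>

lemma cover_number_eq_cov:
  assumes s: "s \<ge> 1"
    and rad: "\<And>T. T \<subseteq> {1..s} \<Longrightarrow> T \<noteq> {} \<Longrightarrow> radical R (ideal_sum R U T) = radical R (ideal_sum R U {1..s})
      \<longleftrightarrow> \<Union>(A ` T) = \<Union>(A ` {1..s})"
  shows "cover_number R s U = cov (A ` {1..s})"
  unfolding cover_number_def cov_def
proof (rule Least_eqI)
  show "s \<ge> 1 \<and> (\<exists>T \<subseteq> {1..s}. card T = s \<and> radical R (ideal_sum R U T) = radical R (ideal_sum R U {1..s}))"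
    using s by auto
next
  fix t assume "t \<ge> 1 \<and> (\<exists>T \<subseteq> {1..s}. card T = t \<and>
      radical R (ideal_sum R U T) = radical R (ideal_sum R U {1..s}))"
  then obtain T where T: "t \<ge> 1" "T \<subseteq> {1..s}" "card T = t"
      "radical R (ideal_sum R U T) = radical R (ideal_sum R U {1..s})" by blast
  have ne: "T \<noteq> {}" using T(1,3) by auto
  have "finite T" using T(2) finite_atLeastAtMost by (rule finite_subset)
  then have "card (A ` T) \<le> t" "card (A ` T) \<ge> 1"
    using T(3) ne card_image_le[of T A] by (simp_all add: Suc_le_eq card_gt_0_iff)
  moreover have "\<Union>(A ` T) = \<Union>(A ` {1..s})" using rad[OF T(2) ne] T(4) by blast
  moreover have "A ` T \<subseteq> A ` {1..s}" using T(2) by (rule image_mono)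
  ultimately show "\<exists>t' \<le> t. t' \<ge> 1 \<and> (\<exists>G \<subseteq> A ` {1..s}. card G = t' \<and> \<Union>G = \<Union>(A ` {1..s}))"
    by blast
next
  fix t assume "t \<ge> 1 \<and> (\<exists>G \<subseteq> A ` {1..s}. card G = t \<and> \<Union>G = \<Union>(A ` {1..s}))"
  then obtain G where G: "t \<ge> 1" "G \<subseteq> A ` {1..s}" "card G = t" "\<Union>G = \<Union>(A ` {1..s})" by blast
  then obtain T where T: "T \<subseteq> {1..s}" "inj_on A T" "G = A ` T"
    unfolding subset_image_inj by blast
  have card: "card T = t" using G(3) T by (simp add: card_image)
  then have "T \<noteq> {}" using G(1) by auto
  then have "radical R (ideal_sum R U T) = radical R (ideal_sum R U {1..s})"
    using rad[OF T(1)] G(4) T(3) by blast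
  then show "\<exists>t' \<le> t. t' \<ge> 1 \<and> (\<exists>T \<subseteq> {1..s}. card T = t' \<and>
      radical R (ideal_sum R U T) = radical R (ideal_sum R U {1..s}))"
    using G(1) T(1) card by blast
qed

text \<open>The right-hand side mentions only \<open>V\<close> and \<open>E\<close>, whence the
  independence of the decomposition. A sum of components has as radical the prime generated by the
  union of their sets, so covers of radicals are covers of sets, and the height is the size of the
  total union.\<close>

lemma decomp_size_assoc:
  fixes V :: "'v::linorder set" and U :: "nat \<Rightarrow> ('v, 'k::field) mpoly set"
  assumes V: "finite V" and dec: "irredundant_primary_decomp V (span_mon E) s U"
  shows "decomp_size V s U
    = int (cov (assoc_sets V E)) + (int (card V) - int (card (\<Union>(assoc_sets V E)))) - 1"
    and "assoc_sets V E \<noteq> {}"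
proof -
  let ?R = "mpoly_ring V :: ('v, 'k) mpoly ring"
  have s: "s \<ge> 1" and U: "\<And>i. i \<in> {1..s} \<Longrightarrow> monomial_ideal V (U i) \<and> primary_ideal ?R (U i)"
    and J: "span_mon E = (\<Inter>i \<in> {1..s}. U i)"
    and irr: "\<And>i. i \<in> {1..s} \<Longrightarrow> (\<Inter>j \<in> {1..s} - {i}. U j) \<noteq> span_mon E"
    using dec unfolding irredundant_primary_decomp_def by blast+
  have "\<forall>i. \<exists>A F. i \<in> {1..s} \<longrightarrow> U i = span_mon F \<and> primary_exps V A F"
    using U primary_ideal_exps by metis
  then obtain A F where AF: "\<And>i. i \<in> {1..s} \<Longrightarrow> U i = span_mon (F i) \<and> primary_exps V (A i) (F i)"
    by metis
  then have UF: "\<And>i. i \<in> {1..s} \<Longrightarrow> U i = span_mon (F i)"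
    and prim: "\<And>i. i \<in> {1..s} \<Longrightarrow> primary_exps V (A i) (F i)" by blast+
  have up: "upset V (F i)" "A i \<subseteq> V" "F i \<subseteq> meets V (A i)" "F i \<subseteq> exps V"
    "\<forall>x \<in> A i. \<exists>k. single x k \<in> F i" "0 \<notin> F i" if "i \<in> {1..s}" for i
    using prim[OF that] primary_exps_subset[OF prim[OF that]] by (auto simp: primary_exps_def upset_def)
  have "(span_mon E :: ('v, 'k) mpoly set) = span_mon (\<Inter>i \<in> {1..s}. F i)"
    unfolding J using UF by (auto simp: span_mon_def)
  then have E: "E = (\<Inter>i \<in> {1..s}. F i)" by (simp add: span_mon_inject)
  have assoc: "assoc_sets V E = A ` {1..s}"
    unfolding E
  proof (rule assoc_sets_decomp[OF V _ prim])
    fix i assume i: "i \<in> {1..s}"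
    \<comment> \<open>For a single component the remaining intersection is the whole type rather
      than the ring, so a polynomial in it need not supply an exponent in \<open>exps V\<close>; the
      exponent 0 serves instead.\<close>
    show "\<exists>m \<in> exps V. m \<notin> F i \<and> (\<forall>j \<in> {1..s} - {i}. m \<in> F j)"
    proof (cases "{1..s} - {i} = {}")
      case True
      then show ?thesis using up(6)[OF i] exps_zero by blast
    next
      case False
      have "span_mon E \<subseteq> (\<Inter>j \<in> {1..s} - {i}. U j)" unfolding J by blast
      then obtain p where p: "p \<in> (\<Inter>j \<in> {1..s} - {i}. U j)" "p \<notin> span_mon E" using irr[OF i] by blast
      then have "p \<notin> U i" unfolding J by blast
      \<comment> \<open>The other components contain all terms of \<open>p\<close>, so one term
        outside \<open>F i\<close> already witnesses irredundancy.\<close>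
      then obtain m where m: "m \<in> keys p" "m \<notin> F i" using UF[OF i] by (auto simp: span_mon_def)
      have "\<forall>j \<in> {1..s} - {i}. m \<in> F j" using p(1) m(1) UF by (fastforce simp: span_mon_def)
      moreover from this have "m \<in> exps V" using False up(4) by blast
      ultimately show ?thesis using m(2) by blast
    qed
  qed simp
  have sum: "ideal_sum ?R U T = span_mon (\<Union>i \<in> T. F i)" if "T \<subseteq> {1..s}" for T
    using that UF up(4) finite_subset[OF that finite_atLeastAtMost] by (intro ideal_sum_span_mon) blast+
  have union: "(\<Union>i \<in> T. F i) \<subseteq> meets V (\<Union>(A ` T))" "upset V (\<Union>i \<in> T. F i)" "\<Union>(A ` T) \<subseteq> V"
    "\<forall>x \<in> \<Union>(A ` T). \<exists>k. single x k \<in> (\<Union>i \<in> T. F i)" if T: "T \<subseteq> {1..s}" for T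
  proof -
    have "F i \<subseteq> meets V (\<Union>(A ` T))" if i: "i \<in> T" for i
    proof -
      have "A i \<subseteq> \<Union>(A ` T)" using i by blast
      then show ?thesis using up(3)[of i] meets_mono[of "A i" "\<Union>(A ` T)" V] T i by blast
    qed
    then show "(\<Union>i \<in> T. F i) \<subseteq> meets V (\<Union>(A ` T))" by (rule UN_least)
    show "upset V (\<Union>i \<in> T. F i)" using up(1) T unfolding upset_def by blast
    show "\<Union>(A ` T) \<subseteq> V" using up(2) T by blast
    show "\<forall>x \<in> \<Union>(A ` T). \<exists>k. single x k \<in> (\<Union>i \<in> T. F i)" using up(5) T by blast
  qed
  have rad: "radical ?R (ideal_sum ?R U T) = span_mon (meets V (\<Union>(A ` T)))" if T: "T \<subseteq> {1..s}" for T
    unfolding sum[OF T]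
    by (intro radical_span_mon union[OF T] finite_subset[OF union(3)[OF T] V])
  have meets_inj: "B = C" if "meets V B = meets V C" "B \<subseteq> V" "C \<subseteq> V" for B C :: "'v set"
  proof -
    have "B = {x \<in> V. single x 1 \<in> meets V B}" if "B \<subseteq> V" for B
      using that by (auto simp: meets_def)
    with that show ?thesis by metis
  qed
  have "cover_number ?R s U = cov (A ` {1..s})"
  proof (rule cover_number_eq_cov[OF s])
    fix T :: "nat set" assume T: "T \<subseteq> {1..s}"
    show "radical ?R (ideal_sum ?R U T) = radical ?R (ideal_sum ?R U {1..s}) \<longleftrightarrow> \<Union>(A ` T) = \<Union>(A ` {1..s})"
      unfolding rad[OF T] rad[OF subset_refl] span_mon_inject
      using meets_inj[OF _ union(3)[OF T] union(3)[OF subset_refl]] by metis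
  qed
  moreover have "height ?R (ideal_sum ?R U {1..s}) = enat (card (\<Union>(A ` {1..s})))"
    unfolding sum[OF subset_refl] by (intro height_span_mon V union subset_refl)
  ultimately show "decomp_size V s U
      = int (cov (assoc_sets V E)) + (int (card V) - int (card (\<Union>(assoc_sets V E)))) - 1"
    by (simp add: decomp_size_def assoc)
  show "assoc_sets V E \<noteq> {}" using s by (simp add: assoc)
qed

section \<open>Existence of irredundant primary decompositions\<close>

lemma nat_mono_subseq:
  fixes s :: "nat \<Rightarrow> nat"
  obtains f :: "nat \<Rightarrow> nat" where "strict_mono f" "\<And>i j. i \<le> j \<Longrightarrow> s (f i) \<le> s (f j)"
proof -
  obtain f :: "nat \<Rightarrow> nat" where f: "strict_mono f" "monoseq (\<lambda>n. s (f n))" using seq_monosub by blast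
  show thesis
  proof (cases "\<forall>m. \<forall>n \<ge> m. s (f m) \<le> s (f n)")
    case True
    with f(1) show thesis by (intro that) auto
  next
    case False
    then have dec: "s (f n) \<le> s (f m)" if "m \<le> n" for m n
      using f(2) that unfolding monoseq_def by blast
    \<comment> \<open>A nonincreasing sequence of naturals is constant from any position where it
      attains its minimum.\<close>
    obtain N where N: "\<And>n. s (f N) \<le> s (f n)"
      using ex_has_least_nat[of "\<lambda>_. True" 0 "\<lambda>n. s (f n)"] by auto
    have const: "s (f (i + N)) = s (f N)" for i using dec[of N "i + N"] N[of "i + N"] by simp
    show thesis
    proof (rule that[of "\<lambda>i. f (i + N)"])
      show "strict_mono (\<lambda>i. f (i + N))" using f(1) by (simp add: strict_mono_def)
    qed (simp add: const)
  qed
qed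

lemma exps_mono_subseq:
  fixes s :: "nat \<Rightarrow> ('v \<Rightarrow>\<^sub>0 nat)"
  assumes "finite V"
  shows "\<exists>f :: nat \<Rightarrow> nat. strict_mono f \<and> (\<forall>x \<in> V. \<forall>i j. i \<le> j \<longrightarrow> lookup (s (f i)) x \<le> lookup (s (f j)) x)"
  using assms
proof (induction V)
  case empty
  have "strict_mono (id :: nat \<Rightarrow> nat)" by (simp add: strict_mono_def)
  then show ?case by blast
next
  case (insert y V)
  then obtain f :: "nat \<Rightarrow> nat" where f: "strict_mono f"
    "\<forall>x \<in> V. \<forall>i j. i \<le> j \<longrightarrow> lookup (s (f i)) x \<le> lookup (s (f j)) x" by blast
  obtain g :: "nat \<Rightarrow> nat" where g: "strict_mono g"
    "\<And>i j. i \<le> j \<Longrightarrow> lookup (s (f (g i))) y \<le> lookup (s (f (g j))) y"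
    using nat_mono_subseq[of "\<lambda>i. lookup (s (f i)) y"] by blast
  have "i \<le> j \<Longrightarrow> g i \<le> g j" for i j using g(1) by (simp add: strict_mono_less_eq)
  then have "\<forall>x \<in> insert y V. \<forall>i j. i \<le> j \<longrightarrow> lookup (s ((f \<circ> g) i)) x \<le> lookup (s ((f \<circ> g) j)) x"
    using f(2) g(2) by simp
  moreover have "strict_mono (f \<circ> g)" using f(1) g(1) by (rule strict_mono_o)
  ultimately show ?case by blast
qed

text \<open>Infinitely many minimal generators would contain a sequence that is nondecreasing in
  every variable, and its first member would properly divide the second.\<close>

lemma finite_min_gens:
  assumes V: "finite V" and I: "monomial_ideal V (I :: ('v, 'k::field) mpoly set)"
  shows "finite (min_gens I)"
proof (rule ccontr)
  assume "\<not> ?thesis"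
  then obtain s :: "nat \<Rightarrow> ('v \<Rightarrow>\<^sub>0 nat)" where s: "inj s" "range s \<subseteq> min_gens I"
    using infinite_countable_subset by blast
  obtain f :: "nat \<Rightarrow> nat" where f: "strict_mono f"
    "\<forall>x \<in> V. \<forall>i j. i \<le> j \<longrightarrow> lookup (s (f i)) x \<le> lookup (s (f j)) x"
    using exps_mono_subseq[OF V] by blast
  have "lookup (s (f 0)) x \<le> lookup (s (f 1)) x" for x
  proof (cases "x \<in> V")
    case True
    then show ?thesis using f(2) by simp
  next
    case False
    have "s (f 0) \<in> exps V" using s(2) min_gens_generate(2)[OF I] by blast
    then have "x \<notin> keys (s (f 0))" using False by (auto simp: exps_def)
    then show ?thesis by (simp add: in_keys_iff)
  qed
  then have "mon_dvd (s (f 0)) (s (f 1))" by (simp add: mon_dvd_def)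
  moreover have "s (f 0) \<in> min_gens I" "s (f 1) \<in> min_gens I" using s(2) by auto
  ultimately have "s (f 0) = s (f 1)" by (auto simp: min_gens_def)
  then have "f 0 = f 1" using s(1) by (auto dest: injD)
  then show False using strict_monoD[OF f(1), of 0 1] by simp
qed

section \<open>Decomposition into irreducible components\<close>

lemma up_closure_min_gens:
  assumes E: "upset V E"
  shows "E = up_closure V (min_gens (span_mon E :: ('v, 'k::field) mpoly set))"
proof -
  have I: "monomial_ideal V (span_mon E :: ('v, 'k) mpoly set)" using E by (auto simp: monomial_ideal_iff)
  show ?thesis
    using min_gens_generate(1)[OF I] Idl_monomials[OF min_gens_generate(2)[OF I], where ?'k = 'k]
    by (simp add: span_mon_inject)
qed

text \<open>Exponents of the monomials in the irreducible ideal generated by the \<open>x ^ lookup b x\<close>,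
  \<open>x \<in> keys b\<close>.\<close>

definition irred_exps :: "'v set \<Rightarrow> ('v \<Rightarrow>\<^sub>0 nat) \<Rightarrow> ('v \<Rightarrow>\<^sub>0 nat) set" where
  "irred_exps V b = {m \<in> exps V. \<exists>x \<in> keys b. lookup b x \<le> lookup m x}"

lemma upset_irred: "upset V (irred_exps V b)"
  by (auto simp: upset_def irred_exps_def lookup_add intro: trans_le_add2)

lemma primary_irred:
  assumes "b \<in> exps V"
  shows "primary_exps V (keys b) (irred_exps V b)"
proof -
  have "single x (lookup b x) \<in> irred_exps V b" if "x \<in> keys b" for x
    using that assms by (auto simp: irred_exps_def exps_def lookup_single intro!: bexI[of _ x])
  moreover have "0 \<notin> irred_exps V b" by (simp add: irred_exps_def in_keys_iff)
  moreover have "m \<in> irred_exps V b"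
    if m: "m \<in> exps V" and disj: "keys u \<inter> keys b = {}" and um: "u + m \<in> irred_exps V b" for u m
  proof -
    obtain x where x: "x \<in> keys b" "lookup b x \<le> lookup (u + m) x"
      using um by (auto simp: irred_exps_def)
    then have "x \<notin> keys u" using disj by blast
    then show ?thesis using x m by (auto simp: irred_exps_def lookup_add in_keys_iff)
  qed
  ultimately show ?thesis
    using assms upset_irred unfolding primary_exps_def exps_def by blast
qed

text \<open>\<open>b\<close> is one above \<open>m\<close>, so \<open>m\<close> just misses the
  component. In a variable where \<open>m\<close> already reaches \<open>B\<close> no generator can
  exceed it, and that variable is left out. This keeps \<open>b\<close> within \<open>B\<close>, so
  finitely many candidates suffice.\<close>

lemma irred_separation:
  assumes V: "finite V" and G: "G \<subseteq> exps V" "\<And>u y. u \<in> G \<Longrightarrow> lookup u y \<le> B"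
    and m: "m \<in> exps V" "m \<notin> up_closure V G"
  obtains b where "b \<in> exps V" "\<And>y. lookup b y \<le> B" "up_closure V G \<subseteq> irred_exps V b" "m \<notin> irred_exps V b"
proof -
  define b where "b = (\<Sum>x \<in> V. single x (if lookup m x < B then lookup m x + 1 else 0))"
  have b: "lookup b y = (if y \<in> V \<and> lookup m y < B then lookup m y + 1 else 0)" for y
    using V by (auto simp: b_def lookup_sum lookup_single when_def sum.delta)
  show thesis
  proof (rule that)
    show "b \<in> exps V" by (auto simp: exps_def in_keys_iff b split: if_splits)
    show "lookup b y \<le> B" for y by (simp add: b)
    show "m \<notin> irred_exps V b" by (auto simp: irred_exps_def in_keys_iff b split: if_splits)
    show "up_closure V G \<subseteq> irred_exps V b"
    proof
      fix w assume "w \<in> up_closure V G"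
      then obtain u where u: "u \<in> G" "mon_dvd u w" "w \<in> exps V" by (auto simp: up_closure_def)
      then have "\<not> mon_dvd u m" using m by (auto simp: up_closure_def)
      then obtain x where x: "lookup m x < lookup u x" by (auto simp: mon_dvd_def not_le)
      then have "x \<in> V" using G(1) u(1) by (fastforce simp: exps_def in_keys_iff)
      moreover have "lookup m x < B" using x G(2)[OF u(1), of x] by simp
      moreover have "lookup u x \<le> lookup w x" using u(2) by (simp add: mon_dvd_def)
      ultimately show "w \<in> irred_exps V b"
        using x u(3) by (auto simp: irred_exps_def in_keys_iff b intro!: bexI[of _ x])
    qed
  qed
qed

text \<open>By separation, \<open>E\<close> is the intersection of the finitely many irreducible
  components with exponents at most \<open>B\<close> that contain it; a subfamily of least
  cardinality is irredundant.\<close>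

lemma ex_irredundant_primary_decomp:
  fixes V :: "'v::linorder set"
  assumes V: "finite V" and E: "upset V E" "0 \<notin> E"
  shows "\<exists>s U. irredundant_primary_decomp V (span_mon E :: ('v, 'k::field) mpoly set) s U"
proof -
  define G where "G = min_gens (span_mon E :: ('v, 'k) mpoly set)"
  have I: "monomial_ideal V (span_mon E :: ('v, 'k) mpoly set)" using E by (auto simp: monomial_ideal_iff)
  have G: "G \<subseteq> exps V" "finite G" "E = up_closure V G"
    using min_gens_generate(2)[OF I] finite_min_gens[OF V I] up_closure_min_gens[OF E(1), where ?'k = 'k]
    by (simp_all add: G_def)
  define W where "W = (\<Union>u \<in> G. lookup u ` keys u)"
  define B where "B = Max (insert 0 W)"
  have "finite W" using G(2) by (simp add: W_def)
  have B: "lookup u y \<le> B" if "u \<in> G" for u y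
  proof (cases "y \<in> keys u")
    case True
    then have "lookup u y \<in> W" using that by (auto simp: W_def)
    then show ?thesis using \<open>finite W\<close> by (simp add: B_def)
  qed (simp add: in_keys_iff)
  define F where "F = {b \<in> exps V. \<forall>y. lookup b y \<le> B} \<inter> {b. E \<subseteq> irred_exps V b}"
  have "finite F" using bounded_exps(1)[OF V] by (simp add: F_def)
  \<comment> \<open>\<open>exps V\<close> guards against the empty family, whose intersection would
    be the whole type. Since \<open>0 \<notin> E\<close>, no family satisfying \<open>?P\<close> is
    empty.\<close>
  let ?P = "\<lambda>C. C \<subseteq> F \<and> exps V \<inter> (\<Inter>b \<in> C. irred_exps V b) = E"
  have "?P F"
  proof (intro conjI subset_refl equalityI subsetI)
    fix m assume m: "m \<in> exps V \<inter> (\<Inter>b \<in> F. irred_exps V b)"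
    show "m \<in> E"
    proof (rule ccontr)
      assume "m \<notin> E"
      then obtain b where "b \<in> exps V" "\<And>y. lookup b y \<le> B" "E \<subseteq> irred_exps V b" "m \<notin> irred_exps V b"
        using irred_separation[OF V G(1) B, of m] m unfolding G(3) by blast
      then show False using m by (auto simp: F_def)
    qed
  qed (use E(1) in \<open>auto simp: F_def upset_def\<close>)
  then obtain C where C: "?P C" and min: "\<And>C'. ?P C' \<Longrightarrow> card C \<le> card C'"
    using ex_has_least_nat[of ?P F card] by blast
  have finC: "finite C" using C \<open>finite F\<close> finite_subset by blast
  have "C \<noteq> {}" using C E(2) by auto
  have inter: "E = (\<Inter>b \<in> C. irred_exps V b)"
    using C \<open>C \<noteq> {}\<close> by (auto simp: irred_exps_def)
  have irr: "\<exists>m. m \<notin> E \<and> (\<forall>b' \<in> C - {b}. m \<in> irred_exps V b')" if b: "b \<in> C" for b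
  proof -
    have "card (C - {b}) < card C" using b finC by (intro psubset_card_mono) auto
    then have "\<not> ?P (C - {b})" using min[of "C - {b}"] by auto
    moreover have "E \<subseteq> exps V \<inter> (\<Inter>b' \<in> C - {b}. irred_exps V b')" using C by blast
    ultimately show ?thesis using C by blast
  qed
  obtain h where h: "bij_betw h {1..card C} C" using ex_bij_betw_nat_finite_1[OF finC] by blast
  define U where "U i = (span_mon (irred_exps V (h i)) :: ('v, 'k) mpoly set)" for i
  have hC: "h i \<in> C" if "i \<in> {1..card C}" for i using h that by (auto simp: bij_betw_def)
  have himg: "h ` {1..card C} = C" using h by (simp add: bij_betw_def)
  have "irredundant_primary_decomp V (span_mon E) (card C) U"
    unfolding irredundant_primary_decomp_def
  proof (intro conjI ballI)
    show "1 \<le> card C" using finC \<open>C \<noteq> {}\<close> by (simp add: Suc_le_eq card_gt_0_iff)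
    fix i assume i: "i \<in> {1..card C}"
    show "monomial_ideal V (U i)" unfolding U_def using upset_irred by (auto simp: monomial_ideal_iff)
    have "h i \<in> exps V" using hC[OF i] C by (auto simp: F_def)
    then show "primary_ideal (mpoly_ring V) (U i)"
      unfolding U_def by (intro primary_ideal_span_mon[OF _ primary_irred]) auto
    obtain m where m: "m \<notin> E" "\<forall>b' \<in> C - {h i}. m \<in> irred_exps V b'" using irr[OF hC[OF i]] by blast
    have "h j \<in> C - {h i}" if "j \<in> {1..card C} - {i}" for j
      using that i hC[of j] inj_on_eq_iff[OF bij_betw_imp_inj_on[OF h], of j i] by simp
    then have "(monomial m :: ('v, 'k) mpoly) \<in> (\<Inter>j \<in> {1..card C} - {i}. U j)"
      using m(2) by (auto simp: U_def)
    moreover have "(monomial m :: ('v, 'k) mpoly) \<notin> span_mon E" using m(1) by simp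
    ultimately show "(\<Inter>j \<in> {1..card C} - {i}. U j) \<noteq> span_mon E" by blast
  next
    have "(\<Inter>b \<in> h ` {1..card C}. irred_exps V b) = (\<Inter>i \<in> {1..card C}. irred_exps V (h i))" by blast
    then have "E = (\<Inter>i \<in> {1..card C}. irred_exps V (h i))" unfolding himg using inter by simp
    then show "span_mon E = (\<Inter>i \<in> {1..card C}. U i)" by (auto simp: U_def span_mon_def)
  qed
  then show ?thesis by blast
qed

lemma ideal_size_span_mon:
  fixes V :: "'v::linorder set"
  assumes V: "finite V" and E: "upset V E" "0 \<notin> E"
  shows "ideal_size V (span_mon E :: ('v, 'k::field) mpoly set)
    = int (cov (assoc_sets V E)) + (int (card V) - int (card (\<Union>(assoc_sets V E)))) - 1"
  unfolding ideal_size_def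
proof (rule the_equality)
  show "\<exists>s U. irredundant_primary_decomp V (span_mon E :: ('v, 'k) mpoly set) s U \<and>
      int (cov (assoc_sets V E)) + (int (card V) - int (card (\<Union>(assoc_sets V E)))) - 1 = decomp_size V s U"
    using ex_irredundant_primary_decomp[OF assms] decomp_size_assoc(1)[OF V] by metis
qed (clarify, rule decomp_size_assoc(1)[OF V])

section \<open>Polarization\<close>

definition pol_exp :: "'v set \<Rightarrow> ('v \<Rightarrow>\<^sub>0 nat) \<Rightarrow> ('v \<times> nat \<Rightarrow>\<^sub>0 nat)" where
  "pol_exp V u = (\<Sum>k \<in> V. \<Sum>l \<in> {1..lookup u k}. single (k, l) 1)"

lemma monomial_sum: "monomial (sum f A) = (\<Prod>i \<in> A. monomial (f i) :: ('v, 'k::field) mpoly)"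
  by (induction A rule: infinite_finite_induct) (simp_all add: mon_mult, simp_all add: monomial_def)

lemma pol_mon_eq: "pol_mon V u = (monomial (pol_exp V u) :: ('v \<times> nat, 'k::field) mpoly)"
  by (simp add: pol_mon_def pol_exp_def monomial_sum var_def)

lemma lookup_sum_single:
  assumes "finite A"
  shows "lookup (\<Sum>x \<in> A. single x (f x)) y = (if y \<in> A then f y else 0)"
proof -
  have "lookup (\<Sum>x \<in> A. single x (f x)) y = (\<Sum>x \<in> A. if x = y then f x else 0)"
    by (simp add: lookup_sum lookup_single when_def)
  then show ?thesis using assms by simp
qed

lemma lookup_pol_exp:
  assumes "finite V"
  shows "lookup (pol_exp V u) (k, l) = (if k \<in> V \<and> 1 \<le> l \<and> l \<le> lookup u k then 1 else 0)"
proof -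
  have "pol_exp V u = (\<Sum>v \<in> (SIGMA k:V. {1..lookup u k}). single v 1)"
    unfolding pol_exp_def using assms by (simp add: sum.Sigma case_prod_beta)
  then show ?thesis using assms by (simp add: lookup_sum_single)
qed

lemma finite_pol_vars: "finite V \<Longrightarrow> finite (pol_vars V I)"
  by (rule finite_subset[of _ "SIGMA k:V. {1..max_exp I k}"]) (auto simp: pol_vars_def)

definition pol_exps :: "'v set \<Rightarrow> ('v, 'k::field) mpoly set \<Rightarrow> ('v \<times> nat \<Rightarrow>\<^sub>0 nat) set" where
  "pol_exps V I = up_closure (pol_vars V I) (pol_exp V ` min_gens I)"

context
  fixes V :: "'v set" and I :: "('v, 'k::field) mpoly set" and E :: "('v \<Rightarrow>\<^sub>0 nat) set"
  assumes V: "finite V" and E: "upset V E" and I: "I = span_mon E"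
begin

lemma monomial_ideal_I: "monomial_ideal V I"
  using E I by (auto simp: monomial_ideal_iff)

lemma min_gens_le_max_exp: "u \<in> min_gens I \<Longrightarrow> lookup u k \<le> max_exp I k"
  unfolding max_exp_def using finite_min_gens[OF V monomial_ideal_I] by (intro Max_ge) auto

lemma pol_exp_in_exps:
  assumes "u \<in> min_gens I"
  shows "pol_exp V u \<in> exps (pol_vars V I)"
proof -
  have "v \<in> pol_vars V I" if "v \<in> keys (pol_exp V u)" for v
    using that min_gens_le_max_exp[OF assms, of "fst v"]
    by (cases v) (auto simp: in_keys_iff lookup_pol_exp[OF V] pol_vars_def split: if_splits)
  then show ?thesis by (auto simp: exps_def)
qed

lemma polarization_eq: "polarization V I = span_mon (pol_exps V I)"
proof -
  have "pol_mon V ` min_gens I = (monomial ` pol_exp V ` min_gens I :: ('v \<times> nat, 'k) mpoly set)"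
    by (simp add: image_image pol_mon_eq)
  then show ?thesis
    unfolding polarization_def pol_exps_def using pol_exp_in_exps by (simp add: Idl_monomials image_subset_iff)
qed

lemma E_eq: "E = up_closure V (min_gens I)"
  unfolding I by (rule up_closure_min_gens[OF E])

text \<open>The first copy \<open>(k, 1)\<close> of each variable dividing \<open>u\<close> divides
  the polarized generator, so a generator polarizing to 1 is itself 1.\<close>

lemma zero_notin_pol_exps:
  assumes "0 \<notin> E"
  shows "0 \<notin> pol_exps V I"
proof
  assume "0 \<in> pol_exps V I"
  then obtain u where u: "u \<in> min_gens I" "mon_dvd (pol_exp V u) 0"
    by (auto simp: pol_exps_def up_closure_def)
  have "lookup u k = 0" for k
  proof (cases "k \<in> V")
    case True
    have "lookup (pol_exp V u) (k, 1) \<le> 0" using u(2) by (simp add: mon_dvd_def)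
    then show ?thesis using True by (simp add: lookup_pol_exp[OF V] split: if_splits)
  next
    case False
    then have "k \<notin> keys u" using min_gens_generate(2)[OF monomial_ideal_I] u(1) by (auto simp: exps_def)
    then show ?thesis by (simp add: in_keys_iff)
  qed
  then have "u = 0" by (intro poly_mapping_eqI) simp
  then show False using u(1) assms by (simp add: min_gens_def I)
qed

text \<open>If \<open>m\<close> has annihilator \<open>A\<close> modulo \<open>I\<close>, then \<open>c\<close> is \<open>x \<mapsto> m\<^sub>x + 1\<close>, and the product of all
  remaining variables has the asserted annihilator modulo the polarization.\<close>

lemma assoc_sets_polarization:
  assumes A: "A \<in> assoc_sets V E"
  shows "\<exists>c. (\<lambda>x. (x, c x)) ` A \<in> assoc_sets (pol_vars V I) (pol_exps V I)"
proof -
  let ?V' = "pol_vars V I"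
  obtain m where AV: "A \<subseteq> V" and m: "m \<in> exps V"
    and eq: "\<And>w. w \<in> exps V \<Longrightarrow> w + m \<in> E \<longleftrightarrow> keys w \<inter> A \<noteq> {}"
    using A by (auto simp: assoc_sets_def)
  define A' where "A' = (\<lambda>x. (x, lookup m x + 1)) ` A"
  define m' where "m' = (\<Sum>v \<in> ?V' - A'. single v (1::nat))"
  have m': "lookup m' v = (if v \<in> ?V' - A' then 1 else 0)" for v
    unfolding m'_def using finite_pol_vars[OF V] by (subst lookup_sum_single) auto
  have gen: "\<exists>u \<in> min_gens I. mon_dvd u (single x 1 + m)" if x: "x \<in> A" for x
  proof -
    have "single x 1 + m \<in> E" using eq[of "single x 1"] x AV by auto
    then show ?thesis using E_eq by (auto simp: up_closure_def)
  qed
  have "A' \<subseteq> ?V'"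
  proof
    fix v assume "v \<in> A'"
    then obtain x where x: "x \<in> A" "v = (x, lookup m x + 1)" by (auto simp: A'_def)
    obtain u where u: "u \<in> min_gens I" "mon_dvd u (single x 1 + m)" using gen[OF x(1)] by blast
    have "m \<notin> E" using eq[of 0] by simp
    then have "\<not> mon_dvd u m" using E_eq u(1) m by (auto simp: up_closure_def)
    \<comment> \<open>\<open>u\<close> divides \<open>x\<close> times \<open>m\<close> but not
      \<open>m\<close>, so it exceeds \<open>m\<close> only at \<open>x\<close>, and there by one.
      Hence the level \<open>lookup m x + 1\<close> occurs in a minimal generator, and the
      polarization has the corresponding variable.\<close>
    then obtain y where y: "lookup m y < lookup u y" by (auto simp: mon_dvd_def not_le)
    moreover have "lookup u y \<le> lookup (single x 1 + m) y" using u(2) by (simp add: mon_dvd_def)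
    ultimately have "y = x" by (auto simp: lookup_add lookup_single when_def split: if_splits)
    then have "lookup m x + 1 \<le> max_exp I x" using y min_gens_le_max_exp[OF u(1), of x] by simp
    then show "v \<in> ?V'" using x AV by (auto simp: pol_vars_def)
  qed
  moreover have "m' \<in> exps ?V'" by (auto simp: exps_def in_keys_iff m' split: if_splits)
  moreover have "w + m' \<in> pol_exps V I \<longleftrightarrow> keys w \<inter> A' \<noteq> {}" if w: "w \<in> exps ?V'" for w
  proof
    assume "keys w \<inter> A' \<noteq> {}"
    then obtain x where x: "x \<in> A" "(x, lookup m x + 1) \<in> keys w" by (auto simp: A'_def)
    obtain u where u: "u \<in> min_gens I" "mon_dvd u (single x 1 + m)" using gen[OF x(1)] by blast
    have "lookup (pol_exp V u) (k, l) \<le> lookup (w + m') (k, l)" for k l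
    proof (cases "k \<in> V \<and> 1 \<le> l \<and> l \<le> lookup u k")
      case True
      then have "(k, l) \<in> ?V'" using min_gens_le_max_exp[OF u(1), of k] by (simp add: pol_vars_def)
      \<comment> \<open>Variables outside \<open>A'\<close> are supplied by \<open>m'\<close>. Of
        those in \<open>A'\<close> only \<open>(x, lookup m x + 1)\<close> can divide the polarized
        \<open>u\<close>, because \<open>u\<close> exceeds \<open>m\<close> at most at
        \<open>x\<close>; this one is supplied by \<open>w\<close>.\<close>
      show ?thesis
      proof (cases "(k, l) \<in> A'")
        case in_A': True
        then have l: "l = lookup m k + 1" by (auto simp: A'_def)
        have "lookup u k \<le> lookup (single x 1 + m) k" using u(2) by (simp add: mon_dvd_def)
        with True l have "k = x" by (auto simp: lookup_add lookup_single when_def split: if_splits)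
        then have "1 \<le> lookup w (k, l)" using x(2) l by (simp add: in_keys_iff)
        then show ?thesis by (simp add: lookup_pol_exp[OF V] lookup_add)
      qed (use \<open>(k, l) \<in> ?V'\<close> in \<open>simp add: lookup_pol_exp[OF V] lookup_add m'\<close>)
    qed (auto simp: lookup_pol_exp[OF V])
    then have "mon_dvd (pol_exp V u) (w + m')" by (auto simp: mon_dvd_def)
    then show "w + m' \<in> pol_exps V I" using u(1) w \<open>m' \<in> exps ?V'\<close> by (auto simp: pol_exps_def up_closure_def)
  next
    assume "w + m' \<in> pol_exps V I"
    then obtain u where u: "u \<in> min_gens I" "mon_dvd (pol_exp V u) (w + m')"
      by (auto simp: pol_exps_def up_closure_def)
    show "keys w \<inter> A' \<noteq> {}"
    proof
      assume disj: "keys w \<inter> A' = {}"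
      \<comment> \<open>Neither \<open>w\<close> nor \<open>m'\<close> involves a variable of
        \<open>A'\<close>, so the polarized \<open>u\<close> misses the level just above
        \<open>m\<close> at each \<open>x\<close> in \<open>A\<close>.\<close>
      have le: "lookup u x \<le> lookup m x" if x: "x \<in> A" for x
      proof (rule ccontr)
        assume "\<not> ?thesis"
        then have "lookup (pol_exp V u) (x, lookup m x + 1) = 1" using x AV by (auto simp: lookup_pol_exp[OF V])
        moreover have inA': "(x, lookup m x + 1) \<in> A'" using x by (simp add: A'_def)
        then have "lookup (w + m') (x, lookup m x + 1) = 0"
          using disj by (auto simp: lookup_add m' in_keys_iff)
        moreover have "lookup (pol_exp V u) (x, lookup m x + 1) \<le> lookup (w + m') (x, lookup m x + 1)"
          using u(2) unfolding mon_dvd_def by blast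
        ultimately show False by simp
      qed
      have uV: "u \<in> exps V" using min_gens_generate(2)[OF monomial_ideal_I] u(1) by blast
      \<comment> \<open>The part of \<open>u\<close> outside \<open>A\<close>: it is free of
        \<open>A\<close>, yet \<open>u\<close> divides its product with \<open>m\<close>, contrary
        to the choice of \<open>m\<close>.\<close>
      define d where "d = (\<Sum>x \<in> V - A. single x (lookup u x))"
      have d: "lookup d x = (if x \<in> V - A then lookup u x else 0)" for x
        unfolding d_def using V by (subst lookup_sum_single) auto
      have "d \<in> exps V" by (auto simp: exps_def in_keys_iff d split: if_splits)
      moreover have "keys d \<inter> A = {}" by (auto simp: in_keys_iff d split: if_splits)
      moreover have "lookup u x \<le> lookup (d + m) x" for x
      proof (cases "x \<in> V")
        case True
        then show ?thesis using le[of x] by (simp add: lookup_add d)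
      next
        case False
        then have "x \<notin> keys u" using uV by (auto simp: exps_def)
        then show ?thesis by (simp add: in_keys_iff)
      qed
      then have "mon_dvd u (d + m)" by (simp add: mon_dvd_def)
      then have "d + m \<in> E" using E_eq u(1) m \<open>d \<in> exps V\<close> by (auto simp: up_closure_def)
      ultimately show False using eq by blast
    qed
  qed
  ultimately have "A' \<in> assoc_sets ?V' (pol_exps V I)" unfolding assoc_sets_def by blast
  then show ?thesis by (intro exI[of _ "\<lambda>x. lookup m x + 1"]) (simp add: A'_def)
qed

end

text \<open>Lift an optimal cover of \<open>\<Union>F\<close> and cover each point still missing by one further set.\<close>

lemma cov_le:
  assumes F: "finite F" "F \<noteq> {}" and fin: "finite (\<Union>F')"
    and lift: "\<And>A. A \<in> F \<Longrightarrow> \<exists>B \<in> F'. p ` B = A"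
  shows "cov F' + card (\<Union>F) \<le> cov F + card (\<Union>F')"
proof -
  have "1 \<le> card F \<and> (\<exists>G \<subseteq> F. card G = card F \<and> \<Union>G = \<Union>F)"
    using F by (auto simp: Suc_le_eq card_gt_0_iff)
  then have "1 \<le> cov F \<and> (\<exists>G \<subseteq> F. card G = cov F \<and> \<Union>G = \<Union>F)"
    unfolding cov_def by (rule LeastI)
  then obtain G where G: "1 \<le> card G" "G \<subseteq> F" "card G = cov F" "\<Union>G = \<Union>F" by auto
  have finG: "finite G" using G(2) F(1) by (rule finite_subset)
  obtain b where b: "\<And>A. A \<in> F \<Longrightarrow> b A \<in> F'" "\<And>A. A \<in> F \<Longrightarrow> p ` b A = A" using lift by metis
  define H where "H = b ` G"
  have HF': "H \<subseteq> F'" using b(1) G(2) by (auto simp: H_def)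
  have cardH: "card H \<le> cov F" using card_image_le[OF finG, of b] G(3) by (simp add: H_def)
  have finUH: "finite (\<Union>H)" using HF' fin by (meson Union_mono finite_subset)
  have "p ` \<Union>H = (\<Union>A \<in> G. p ` b A)" by (auto simp: H_def)
  also have "\<dots> = (\<Union>A \<in> G. A)" using b(2) G(2) by (intro SUP_cong) auto
  also have "\<dots> = \<Union>F" using G(4) by simp
  finally have "card (\<Union>F) \<le> card (\<Union>H)" using card_image_le[OF finUH, of p] by simp
  obtain g where g: "\<And>y. y \<in> \<Union>F' \<Longrightarrow> g y \<in> F' \<and> y \<in> g y" 
  proof -
    have "\<forall>y. \<exists>B. y \<in> \<Union>F' \<longrightarrow> B \<in> F' \<and> y \<in> B" by blast
    then show thesis using that by metis
  qed
  define R where "R = \<Union>F' - \<Union>H"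
  define K where "K = H \<union> g ` R"
  have finR: "finite R" using fin by (simp add: R_def)
  have finH: "finite H" using finG by (simp add: H_def)
  have "K \<subseteq> F'" using HF' g by (auto simp: K_def R_def)
  moreover have "\<Union>F' \<subseteq> \<Union>K"
  proof
    fix y assume y: "y \<in> \<Union>F'"
    show "y \<in> \<Union>K"
    proof (cases "y \<in> \<Union>H")
      case True
      then show ?thesis by (auto simp: K_def)
    next
      case False
      then have "y \<in> R" using y by (simp add: R_def)
      then show ?thesis using g[OF y] by (auto simp: K_def)
    qed
  qed
  ultimately have "K \<subseteq> F'" "\<Union>K = \<Union>F'" by blast+
  moreover have "1 \<le> card K"
    using G(1) finH finR by (auto simp: Suc_le_eq card_gt_0_iff K_def H_def)
  ultimately have "cov F' \<le> card K" unfolding cov_def by (intro Least_le) blast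
  also have "\<dots> \<le> card H + card R"
    unfolding K_def using card_Un_le[of H "g ` R"] card_image_le[OF finR, of g] by linarith
  also have "card R = card (\<Union>F') - card (\<Union>H)"
    unfolding R_def using HF' by (intro card_Diff_subset finUH) blast
  finally have "cov F' \<le> card H + (card (\<Union>F') - card (\<Union>H))" .
  moreover have "card (\<Union>H) \<le> card (\<Union>F')" using HF' by (intro card_mono fin) blast
  ultimately show ?thesis using cardH \<open>card (\<Union>F) \<le> card (\<Union>H)\<close> by linarith
qed

theorem theorem3p7:
  fixes n :: nat and I :: "(nat, 'k::field) mpoly set"
  assumes "monomial_ideal {1..n} I"
    and "I \<noteq> carrier (mpoly_ring {1..n})"
  shows "ideal_size (pol_vars {1..n} I) (polarization {1..n} I)
    \<le> ideal_size {1..n} I + (int (card (pol_vars {1..n} I)) - int n)"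
proof -
  let ?V = "{1..n}"
  let ?V' = "pol_vars ?V I"
  obtain E where E: "upset ?V E" and I: "I = span_mon E"
    using assms(1) by (auto simp: monomial_ideal_iff)
  have zero: "0 \<notin> E"
  proof
    assume "0 \<in> E"
    then have "E = exps ?V" using E upset_addI[OF E, of 0] by (auto simp: upset_def)
    then show False using assms(2) by (simp add: I carrier_span)
  qed
  define E' where "E' = pol_exps ?V I"
  have V': "finite ?V'" by (simp add: finite_pol_vars)
  have E': "upset ?V' E'" "0 \<notin> E'"
    using zero_notin_pol_exps[OF _ E I zero] upset_up_closure by (simp_all add: E'_def pol_exps_def)
  let ?F = "assoc_sets ?V E" and ?F' = "assoc_sets ?V' E'"
  have "?F \<subseteq> Pow ?V" by (auto simp: assoc_sets_def)
  then have "finite ?F" using finite_subset by blast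
  moreover have "?F \<noteq> {}"
    using ex_irredundant_primary_decomp[OF _ E zero, where ?'k = 'k] decomp_size_assoc(2)[of ?V E, where ?'k = 'k]
    by blast
  moreover have "\<Union>?F' \<subseteq> ?V'" by (auto simp: assoc_sets_def)
  then have "finite (\<Union>?F')" using V' finite_subset by blast
  moreover have "\<exists>B \<in> ?F'. fst ` B = A" if A: "A \<in> ?F" for A
  proof -
    obtain c where "(\<lambda>x. (x, c x)) ` A \<in> ?F'"
      using assoc_sets_polarization[OF _ E I A] by (auto simp: E'_def)
    moreover have "fst ` (\<lambda>x. (x, c x)) ` A = A" by (simp add: image_image)
    ultimately show ?thesis by blast
  qed
  \<comment> \<open>The cardinalities of the unions are the subtracted terms of the two size
    formulas; what remains to be compared are the numbers of variables, whose difference is the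
    shift on the right-hand side.\<close>
  ultimately have "cov ?F' + card (\<Union>?F) \<le> cov ?F + card (\<Union>?F')" by (rule cov_le)
  moreover have "ideal_size ?V I = int (cov ?F) + (int n - int (card (\<Union>?F))) - 1"
    unfolding I using ideal_size_span_mon[OF _ E zero] by simp
  moreover have "polarization ?V I = span_mon E'"
    unfolding E'_def by (rule polarization_eq[OF _ E I]) simp
  then have "ideal_size ?V' (polarization ?V I)
      = int (cov ?F') + (int (card ?V') - int (card (\<Union>?F'))) - 1"
    using ideal_size_span_mon[OF V' E'] by simp
  ultimately show ?thesis by linarith
qed

end
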